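(* Let $m>2$ and suppose that the random vector $X_0\in\mathbb{R}^p$ is weakly $m$-th order isotropic with constant $C_m$. Define $$D_m := [2C_m]^{\frac{m}{m-1}}\,\frac{m-1}{m-2}.$$ Then for all $t>0$, with probability at least $1-\exp[-t]$, $$\inf_{u\in\mathbb{R}^p:\ \|X_0^Tu\|_2=1}\|Xu\|_{2,n}^2-1\ \ge\ -\left[D_m\left(16\sqrt{\frac pn}+\sqrt{\frac{2t}{n}}\right)^{\frac{m-2}{m-1}}+\frac{8D_m^2}{3}\left(\frac tn\right)^{\frac{m-2}{m-1}}\right].$$ If in addition the entries of $X_0$ are Bernstein with constants $\sigma_X$ and $K_X$, then for every $M\ge 1$ and all $t>0$, with probability at least $1-\exp[-t]$, $$\inf_{u\in\mathbb{R}^p:\ \|X_0^Tu\|_2=1,\ \|u\|_1\le M}\|Xu\|_{2,n}^2-1\ \ge\ -\Delta_n^{\rm L}(M,t),$$ where $$\Delta_n^{\rm L}(M,t):=D_m\left(16M\delta_n+\sqrt{\frac{2t}{n}}\right)^{\frac{m-2}{m-1}}+\frac{8D_m^2}{3}\left(\frac tn\right)^{\frac{m-2}{m-1}},\qquad \delta_n:=\sigma_X\sqrt{\frac{2\log(2p)}{n}}+K_X\frac{\log(2p)}{n}.$$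
   Context: $X$ is an $n\times p$ random matrix whose rows are i.i.d. copies of $X_0^T$, where $X_0$ is a random vector in $\mathbb{R}^p$ for which $\Sigma_0:=\mathbb{E}X_0X_0^T$ exists ($\Sigma_0$ may be singular). For a real random variable $Z$ and $m\ge1$, $\|Z\|_m:=(\mathbb{E}|Z|^m)^{1/m}$; thus $\|X_0^Tu\|_2^2=u^T\Sigma_0u$. For $u\in\mathbb{R}^p$, $\|u\|_1$ is the $\ell_1$-norm and $\|Xu\|_{2,n}^2:=\frac1n\sum_{i=1}^n((Xu)_i)^2$. Weak isotropy: $X_0$ is weakly $m$-th order isotropic with constant $C_m$ if for all $u\in\mathbb{R}^p$ with $\|X_0^Tu\|_2=1$ one has $\mathbb{P}(|X_0^Tu|>t)\le (C_m/t)^m$ for all $t>0$. Bernstein: a real random variable $Z$ is Bernstein with constants $\sigma$ and $K$ if $\mathbb{E}|Z|^k\le\frac{k!}{2}K^{k-2}\sigma^2$ for all $k\in\{2,3,\ldots\}$. *)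

theory Defs
  imports "HOL-Probability.Probability"
begin

text \<open>The norm \<open>\<parallel>Z\<parallel>\<^sub>m\<close> of a real random variable.  The Bochner integral is 0 for a
  non-integrable integrand, so this is meaningful only when \<open>\<bar>Z\<bar>\<^sup>m\<close> is integrable.\<close>

definition Lnorm :: "'a measure \<Rightarrow> real \<Rightarrow> ('a \<Rightarrow> real) \<Rightarrow> real" where
  "Lnorm P m Z = (\<integral>\<omega>. \<bar>Z \<omega>\<bar> powr m \<partial>P) powr (1 / m)"

definition l1_norm :: "real ^ 'p \<Rightarrow> real" where
  "l1_norm u = (\<Sum>j\<in>UNIV. \<bar>u $ j\<bar>)"

text \<open>The squared empirical norm \<open>\<parallel>v\<parallel>\<^sup>2\<close> with index \<open>2,n\<close> on \<open>\<real>\<^sup>n\<close>, where \<open>n\<close> is the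
  cardinality of the index type.\<close>

definition emp_norm_sq :: "real ^ 'n \<Rightarrow> real" where
  "emp_norm_sq v = 1 / real CARD('n) * (\<Sum>i\<in>UNIV. (v $ i)\<^sup>2)"

text \<open>Existence of \<open>\<Sigma>\<^sub>0 = E X\<^sub>0 X\<^sub>0\<^sup>T\<close>: the matrix-valued random variable \<open>X\<^sub>0 X\<^sub>0\<^sup>T\<close> is integrable.\<close>

definition second_moment_exists :: "'a measure \<Rightarrow> ('a \<Rightarrow> real ^ 'p) \<Rightarrow> bool" where
  "second_moment_exists P X0 \<longleftrightarrow> integrable P (\<lambda>\<omega>. (\<chi> j k. X0 \<omega> $ j * X0 \<omega> $ k) :: real ^ 'p ^ 'p)"

definition weakly_isotropic :: "'a measure \<Rightarrow> ('a \<Rightarrow> real ^ 'p) \<Rightarrow> real \<Rightarrow> real \<Rightarrow> bool" where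
  "weakly_isotropic P X0 m C \<longleftrightarrow>
     (\<forall>u. Lnorm P 2 (\<lambda>\<omega>. X0 \<omega> \<bullet> u) = 1 \<longrightarrow>
        (\<forall>t>0. measure P {\<omega> \<in> space P. \<bar>X0 \<omega> \<bullet> u\<bar> > t} \<le> (C / t) powr m))"

text \<open>Finiteness of the moments has to be required explicitly, because the Bochner integral
  of a non-integrable function is 0.\<close>

definition bernstein :: "'a measure \<Rightarrow> ('a \<Rightarrow> real) \<Rightarrow> real \<Rightarrow> real \<Rightarrow> bool" where
  "bernstein P Z \<sigma> K \<longleftrightarrow>
     (\<forall>k::nat. k \<ge> 2 \<longrightarrow>
        integrable P (\<lambda>\<omega>. \<bar>Z \<omega>\<bar> ^ k) \<and>
        (\<integral>\<omega>. \<bar>Z \<omega>\<bar> ^ k \<partial>P) \<le> fact k / 2 * K ^ (k - 2) * \<sigma>\<^sup>2)"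

definition D_const :: "real \<Rightarrow> real \<Rightarrow> real" where
  "D_const m C = (2 * C) powr (m / (m - 1)) * ((m - 1) / (m - 2))"

definition delta :: "nat \<Rightarrow> nat \<Rightarrow> real \<Rightarrow> real \<Rightarrow> real" where
  "delta n p \<sigma> K = \<sigma> * sqrt (2 * ln (2 * real p) / real n) + K * (ln (2 * real p) / real n)"

definition Delta_L ::
  "nat \<Rightarrow> nat \<Rightarrow> real \<Rightarrow> real \<Rightarrow> real \<Rightarrow> real \<Rightarrow> real \<Rightarrow> real \<Rightarrow> real" where
  "Delta_L n p m C \<sigma> K M t =
     D_const m C * (16 * M * delta n p \<sigma> K + sqrt (2 * t / real n)) powr ((m - 2) / (m - 1))
     + 8 * (D_const m C)\<^sup>2 / 3 * (t / real n) powr ((m - 2) / (m - 1))"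

end

theory Submission
  imports Defs
begin

text \<open>
  Truncate \<open>(x \<bullet> u)\<^sup>2\<close> at \<open>K\<^sup>2\<close>, calling the result \<open>f u x\<close>, and let \<open>Z\<close> be the supremum over \<open>u\<close>
  of \<open>\<Sum>i. E (f u) - f u (x i)\<close>.  Weak isotropy bounds the bias \<open>1 - E (f u)\<close> by a multiple of
  \<open>C powr m * K powr (2 - m)\<close>.  As \<open>f\<close> is nonnegative, replacing one row lowers \<open>Z\<close> by at most
  the truncated square of the new row in the direction that was optimal before, and that square
  has second moment at most \<open>K\<^sup>2\<close>.  Hence every martingale difference of \<open>Z\<close> has conditional
  variance at most \<open>K\<^sup>2\<close>, and an elementary exponential bound replaces Bousquet's inequality; the
  worse constants are absorbed by the factor 2 in \<open>(2 * C) powr (m / (m - 1))\<close>.  The mean of \<open>Z\<close>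
  is bounded by symmetrization and contraction, one row at a time, since \<open>f u x\<close> is a
  \<open>2 * K\<close>-Lipschitz function of \<open>x \<bullet> u\<close>.  The remaining linear process is handled by orthonormality in
  \<open>L\<^sup>2\<close> in the first case and by the Bernstein bound for the maximum of the coordinates in the
  second.
\<close>

section \<open>Concentration of maxima of sums\<close>

text \<open>A maximum over a finite set \<open>F\<close> of directions replaces the supremum: it is
  measurable and attained, and no bound depends on the size of \<open>F\<close>, so a countable
  dense set of directions can be exhausted at the end. Attainment matters in the variance bound and
  in the contraction step, which both compare maxima through their maximizers.

  The constants are spent as follows. Let \<open>a0\<close> bound the mean maximum of the linear
  process per row. Symmetrization costs 2 and the truncated square is
  \<open>2 * K\<close>-Lipschitz, so the mean of \<open>Z / n\<close> is at most
  \<open>4 * K * a0\<close>; the exponential bound adds \<open>2 * K * sqrt (t / n)\<close> and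
  \<open>K\<^sup>2 * t / n\<close>. With \<open>a = 16 * a0 + sqrt (2 * t / n)\<close> the terms
  linear in \<open>K\<close> are at most \<open>2 * K * a\<close>, and \<open>K\<close> is chosen so
  that the bias bound is \<open>2 * K * a / (m - 2)\<close>. Their sum is
  \<open>2 * K * a * (m - 1) / (m - 2)\<close>, which fits because
  \<open>2 powr (m / (m - 1))\<close> is at least 2.\<close>

lemma exp_le_quadratic:
  fixes s :: real
  assumes "\<bar>s\<bar> \<le> 1"
  shows "exp s \<le> 1 + s + s\<^sup>2"
proof (cases "s \<ge> 0")
  case True
  then show ?thesis using exp_bound[of s] assms by simp
next
  case False
  define r where "r = - s"
  have r: "0 < r" using False by (simp add: r_def)
  have "exp s = 1 / exp r" by (simp add: r_def exp_minus field_simps)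
  also have "\<dots> \<le> 1 / (1 + r)"
    using r by (intro divide_left_mono exp_ge_add_one_self) auto
  also have "\<dots> \<le> 1 - r + r\<^sup>2"
  proof -
    have "(1 - r + r\<^sup>2) * (1 + r) = 1 + r ^ 3" by (simp add: algebra_simps power2_eq_square power3_eq_cube)
    then show ?thesis using r by (simp add: field_simps)
  qed
  finally show ?thesis by (simp add: r_def)
qed

text \<open>The maximizer \<open>u\<close> of \<open>a\<close> is chosen before \<open>b\<close>, so
  one direction serves all competitors at once. The variance bound relies on this order: there
  \<open>b\<close> depends on the fresh copy \<open>y\<close> that is integrated out while
  \<open>u\<close> stays fixed.\<close>

lemma Max_image_diff_le:
  fixes a b :: "'u \<Rightarrow> real"
  assumes "finite F" "F \<noteq> {}"
  obtains u where "u \<in> F" "\<And>b. Max (a ` F) - Max (b ` F) \<le> a u - b u"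
proof -
  have "Max (a ` F) \<in> a ` F" using assms by (intro Max_in) auto
  then obtain u where u: "u \<in> F" "Max (a ` F) = a u" by auto
  have "b u \<le> Max (b ` F)" for b :: "'u \<Rightarrow> real" using u assms by auto
  with u that show thesis by (metis diff_left_mono)
qed

lemma abs_Max_image_le_sum:
  fixes a :: "'u \<Rightarrow> real"
  assumes "finite F" "F \<noteq> {}"
  shows "\<bar>Max (a ` F)\<bar> \<le> (\<Sum>u\<in>F. \<bar>a u\<bar>)"
proof -
  have "Max (a ` F) \<in> a ` F" using assms by (intro Max_in) auto
  then obtain u where u: "u \<in> F" "Max (a ` F) = a u" by auto
  then show ?thesis using member_le_sum[of u F "\<lambda>u. \<bar>a u\<bar>"] assms by auto
qed

lemma integrable_Max_image:
  fixes a :: "'u \<Rightarrow> 'x \<Rightarrow> real"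
  assumes "finite F" "F \<noteq> {}" and int: "\<And>u. u \<in> F \<Longrightarrow> integrable M (a u)"
  shows "integrable M (\<lambda>x. Max ((\<lambda>u. a u x) ` F))"
proof (rule Bochner_Integration.integrable_bound)
  show "integrable M (\<lambda>x. \<Sum>u\<in>F. \<bar>a u x\<bar>)" using int by (intro Bochner_Integration.integrable_sum) auto
  show "(\<lambda>x. Max ((\<lambda>u. a u x) ` F)) \<in> borel_measurable M"
    using assms by (intro borel_measurable_Max) auto
  show "AE x in M. norm (Max ((\<lambda>u. a u x) ` F)) \<le> norm (\<Sum>u\<in>F. \<bar>a u x\<bar>)"
    using abs_Max_image_le_sum[OF assms(1,2)] by (auto simp: abs_of_nonneg sum_nonneg)
qed

lemma (in prob_space) expectation_mono_const:
  fixes f :: "'a \<Rightarrow> real"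
  assumes "integrable M f" "\<And>x. f x \<le> c" shows "expectation f \<le> c"
  by (rule integral_le_const) (use assms in auto)

text \<open>For an independent copy, \<open>2 * variance R\<close> is the mean of
  \<open>(R x - R y)\<^sup>2\<close>, which splits into the squares of two positive parts;
  exchanging the copies makes their integrals equal. So only decreases from \<open>x\<close> to
  \<open>y\<close> have to be controlled. The bound \<open>B\<close> provides integrability and does
  not enter the estimate.\<close>

lemma (in prob_space) variance_le_pairwise:
  fixes R :: "'a \<Rightarrow> real"
  assumes meas[measurable]: "R \<in> borel_measurable M"
    and bd: "\<And>x. \<bar>R x\<bar> \<le> B"
    and le: "\<And>x. expectation (\<lambda>y. (max 0 (R x - R y))\<^sup>2) \<le> v"
  shows "variance R \<le> v"
proof -
  interpret pp: pair_prob_space M M ..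
  have i1: "integrable M R" by (rule integrable_const_bound[of _ B]) (use bd in auto)
  have bd2: "(R x)\<^sup>2 \<le> B\<^sup>2" for x using bd[of x] abs_le_square_iff[of "R x" B] by force
  have i2: "integrable M (\<lambda>x. (R x)\<^sup>2)"
    by (rule integrable_const_bound[of _ "B\<^sup>2"]) (use bd2 in auto)
  have bdm: "(max 0 (R x - R y))\<^sup>2 \<le> (2 * B)\<^sup>2" for x y
    using bd[of x] bd[of y] by (intro power_mono) auto
  have im: "integrable (M \<Otimes>\<^sub>M M) (\<lambda>(x, y). (max 0 (R x - R y))\<^sup>2)"
    by (rule pp.integrable_const_bound[of _ "(2*B)\<^sup>2"]) (use bdm in auto)
  have im1: "integrable M (\<lambda>y. (max 0 (R x - R y))\<^sup>2)" for x
    by (rule integrable_const_bound[of _ "(2*B)\<^sup>2"]) (use bdm in auto)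
  have im2: "integrable M (\<lambda>y. (max 0 (R y - R x))\<^sup>2)" for x
    by (rule integrable_const_bound[of _ "(2*B)\<^sup>2"]) (use bdm in auto)
  have io: "integrable M (\<lambda>x. \<integral>y. (max 0 (R x - R y))\<^sup>2 \<partial>M)"
    using pp.integrable_fst'[OF im] by simp
  have io2: "integrable M (\<lambda>x. \<integral>y. (max 0 (R y - R x))\<^sup>2 \<partial>M)"
    using pp.integrable_snd[OF im] by simp
  have "2 * variance R = 2 * (expectation (\<lambda>x. (R x)\<^sup>2) - (expectation R)\<^sup>2)"
    by (simp add: variance_eq[OF i1 i2])
  also have "\<dots> = (\<integral>x. (R x)\<^sup>2 - 2 * R x * expectation R + expectation (\<lambda>x. (R x)\<^sup>2) \<partial>M)"
    using i1 i2 by (simp add: prob_space power2_eq_square)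
  also have "\<dots> = (\<integral>x. (\<integral>y. (R x - R y)\<^sup>2 \<partial>M) \<partial>M)"
    using i1 i2 by (intro Bochner_Integration.integral_cong) (simp_all add: power2_diff prob_space)
  also have "\<dots> = (\<integral>x. (\<integral>y. (max 0 (R x - R y))\<^sup>2 + (max 0 (R y - R x))\<^sup>2 \<partial>M) \<partial>M)"
    by (intro Bochner_Integration.integral_cong) (auto simp: max_def power2_commute)
  also have "\<dots> = (\<integral>x. (\<integral>y. (max 0 (R x - R y))\<^sup>2 \<partial>M) + (\<integral>y. (max 0 (R y - R x))\<^sup>2 \<partial>M) \<partial>M)"
    using im1 im2 by simp
  also have "\<dots> = (\<integral>x. (\<integral>y. (max 0 (R x - R y))\<^sup>2 \<partial>M) \<partial>M) + (\<integral>x. (\<integral>y. (max 0 (R y - R x))\<^sup>2 \<partial>M) \<partial>M)"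
    using io io2 by simp
  also have "(\<integral>x. (\<integral>y. (max 0 (R y - R x))\<^sup>2 \<partial>M) \<partial>M) = (\<integral>y. (\<integral>x. (max 0 (R y - R x))\<^sup>2 \<partial>M) \<partial>M)"
    using pp.Fubini_integral[of "\<lambda>x y. (max 0 (R x - R y))\<^sup>2"] im by simp
  also have "(\<integral>x. (\<integral>y. (max 0 (R x - R y))\<^sup>2 \<partial>M) \<partial>M) \<le> v"
    by (rule expectation_mono_const[OF io le])
  finally show ?thesis by simp
qed

text \<open>The mean of \<open>R\<close> is an average of values \<open>R y\<close>, so
  \<open>osc\<close>, used in both directions, keeps \<open>R\<close> within \<open>b\<close> of its
  mean. Then \<open>l * b \<le> 1\<close> puts the exponent in the range of
  \<open>exp_le_quadratic\<close>, whose linear term integrates to zero.\<close>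

lemma (in prob_space) exp_moment_le_variance:
  fixes R :: "'a \<Rightarrow> real"
  assumes meas[measurable]: "R \<in> borel_measurable M"
    and bd: "\<And>x. \<bar>R x\<bar> \<le> B" and osc: "\<And>x y. R x - R y \<le> b"
    and "0 \<le> l" "l * b \<le> 1"
  shows "expectation (\<lambda>x. exp (l * (R x - expectation R))) \<le> exp (l\<^sup>2 * variance R)"
proof -
  let ?D = "\<lambda>x. R x - expectation R"
  have i1: "integrable M R" by (rule integrable_const_bound[of _ B]) (use bd in auto)
  have le: "?D x \<le> b" for x
  proof -
    have "?D x = (\<integral>y. R x - R y \<partial>M)" using i1 by (simp add: prob_space)
    also have "\<dots> \<le> b" using i1 by (intro expectation_mono_const osc) auto
    finally show ?thesis .
  qed
  have ge: "- b \<le> ?D x" for x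
  proof -
    have "- ?D x = (\<integral>y. R y - R x \<partial>M)" using i1 by (simp add: prob_space)
    also have "\<dots> \<le> b" using i1 by (intro expectation_mono_const osc) auto
    finally show ?thesis by simp
  qed
  have ab: "\<bar>?D x\<bar> \<le> b" for x using le[of x] ge[of x] by (simp add: abs_le_iff)
  have lD: "\<bar>l * ?D x\<bar> \<le> 1" for x
  proof -
    have "\<bar>l * ?D x\<bar> \<le> l * b" using ab[of x] assms(4) by (simp add: abs_mult mult_left_mono)
    then show ?thesis using assms(5) by simp
  qed
  have sq: "(?D x)\<^sup>2 \<le> b\<^sup>2" for x using ab[of x] by (metis abs_ge_zero power2_abs power_mono)
  have i2: "integrable M (\<lambda>x. (?D x)\<^sup>2)"
    by (rule integrable_const_bound[of _ "b\<^sup>2"]) (use sq in auto)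
  have ie: "integrable M (\<lambda>x. exp (l * ?D x))"
    by (rule integrable_const_bound[of _ "exp 1"]) (use lD abs_le_D1 in auto)
  have "expectation (\<lambda>x. exp (l * ?D x)) \<le> expectation (\<lambda>x. 1 + l * ?D x + l\<^sup>2 * (?D x)\<^sup>2)"
    using exp_le_quadratic[OF lD] i1 i2 ie by (intro integral_mono) (auto simp: power_mult_distrib)
  also have "\<dots> = 1 + l\<^sup>2 * variance R"
    using i1 i2 by (simp add: prob_space)
  also have "\<dots> \<le> exp (l\<^sup>2 * variance R)" by (rule exp_ge_add_one_self)
  finally show ?thesis .
qed

text \<open>Since \<open>f\<close> is nonnegative, raising \<open>x\<close> to \<open>y\<close> lowers the maximum by at most the value
  at \<open>y\<close> of the function selected at \<open>x\<close>, so the second moments of the single functions control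
  the variance of the maximum.\<close>

lemma (in prob_space) exp_moment_Max:
  fixes f :: "'u \<Rightarrow> 'a \<Rightarrow> real" and g :: "'u \<Rightarrow> real"
  assumes F: "finite F" "F \<noteq> {}"
    and meas: "\<And>u. u \<in> F \<Longrightarrow> f u \<in> borel_measurable M"
    and f: "\<And>u x. u \<in> F \<Longrightarrow> 0 \<le> f u x" "\<And>u x. u \<in> F \<Longrightarrow> f u x \<le> b"
    and v: "\<And>u. u \<in> F \<Longrightarrow> expectation (\<lambda>x. (f u x)\<^sup>2) \<le> v"
    and l: "0 \<le> l" "l * b \<le> 1"
  defines "R \<equiv> \<lambda>x. Max ((\<lambda>u. g u - f u x) ` F)"
  shows "expectation (\<lambda>x. exp (l * (R x - expectation R))) \<le> exp (l\<^sup>2 * v)"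
proof -
  have R[measurable]: "R \<in> borel_measurable M"
    unfolding R_def using F meas by (intro borel_measurable_Max) auto
  obtain B where B: "\<And>x. \<bar>R x\<bar> \<le> B"
  proof
    fix x
    have "\<bar>R x\<bar> \<le> (\<Sum>u\<in>F. \<bar>g u - f u x\<bar>)" unfolding R_def by (rule abs_Max_image_le_sum[OF F])
    also have "\<dots> \<le> (\<Sum>u\<in>F. \<bar>g u\<bar> + b)"
      using f by (intro sum_mono) (smt (verit))
    finally show "\<bar>R x\<bar> \<le> (\<Sum>u\<in>F. \<bar>g u\<bar> + b)" .
  qed
  have sel: "\<exists>u\<in>F. \<forall>y. R x - R y \<le> f u y" for x
  proof -
    obtain u where u: "u \<in> F" "\<And>b. Max ((\<lambda>u. g u - f u x) ` F) - Max (b ` F) \<le> (g u - f u x) - b u"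
      using Max_image_diff_le[OF F, of "\<lambda>u. g u - f u x"] by metis
    have "R x - R y \<le> f u y" for y
      using u(2)[of "\<lambda>u. g u - f u y"] f(1)[OF u(1), of x] by (simp add: R_def)
    with u(1) show ?thesis by auto
  qed
  have osc: "R x - R y \<le> b" for x y using sel[of x] f(2) order_trans by blast
  have "variance R \<le> v"
  proof (rule variance_le_pairwise[OF R B])
    fix x
    obtain u where u: "u \<in> F" "\<And>y. R x - R y \<le> f u y" using sel by blast
    have sq: "(max 0 (R x - R y))\<^sup>2 \<le> (f u y)\<^sup>2" for y
      using u f(1)[OF u(1)] by (intro power_mono) auto
    have fb: "(f u y)\<^sup>2 \<le> b\<^sup>2" for y using f u(1) by (intro power_mono) auto
    have mm: "f u \<in> borel_measurable M" using meas u(1) by auto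
    have "expectation (\<lambda>y. (max 0 (R x - R y))\<^sup>2) \<le> expectation (\<lambda>y. (f u y)\<^sup>2)"
    proof (rule integral_mono)
      show "integrable M (\<lambda>y. (max 0 (R x - R y))\<^sup>2)"
        by (rule integrable_const_bound[of _ "b\<^sup>2"]) (use order_trans[OF sq fb] in auto)
      show "integrable M (\<lambda>y. (f u y)\<^sup>2)"
        by (rule integrable_const_bound[of _ "b\<^sup>2"]) (use fb mm in auto)
    qed (use sq in auto)
    with v[OF u(1)] show "expectation (\<lambda>y. (max 0 (R x - R y))\<^sup>2) \<le> v" by simp
  qed
  then have "exp (l\<^sup>2 * variance R) \<le> exp (l\<^sup>2 * v)" by (simp add: mult_left_mono)
  with exp_moment_le_variance[OF R B osc l] show ?thesis by linarith
qed

lemma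
  fixes h :: "('i \<Rightarrow> 'x) \<Rightarrow> real"
  assumes Q: "prob_space Q" and h: "h \<in> borel_measurable (PiM (insert i I) (\<lambda>_. Q))"
  shows integral_PiM_insert_pair:
      "(\<integral>y. h y \<partial>PiM (insert i I) (\<lambda>_. Q)) = (\<integral>z. h ((snd z)(i := fst z)) \<partial>(Q \<Otimes>\<^sub>M PiM I (\<lambda>_. Q)))"
    and integrable_PiM_insert_pair:
      "integrable (PiM (insert i I) (\<lambda>_. Q)) h \<longleftrightarrow>
       integrable (Q \<Otimes>\<^sub>M PiM I (\<lambda>_. Q)) (\<lambda>z. h ((snd z)(i := fst z)))"
proof -
  have eq: "PiM (insert i I) (\<lambda>_. Q) =
      distr (Q \<Otimes>\<^sub>M PiM I (\<lambda>_. Q)) (PiM (insert i I) (\<lambda>_. Q)) (\<lambda>z. (snd z)(i := fst z))"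
    using distr_pair_PiM_eq_PiM[of I "\<lambda>_. Q" i] Q by (simp add: case_prod_beta')
  have m: "(\<lambda>z. (snd z)(i := fst z)) \<in> Q \<Otimes>\<^sub>M PiM I (\<lambda>_. Q) \<rightarrow>\<^sub>M PiM (insert i I) (\<lambda>_. Q)"
    by measurable
  show "(\<integral>y. h y \<partial>PiM (insert i I) (\<lambda>_. Q)) = (\<integral>z. h ((snd z)(i := fst z)) \<partial>(Q \<Otimes>\<^sub>M PiM I (\<lambda>_. Q)))"
    by (subst eq) (rule integral_distr[OF m h])
  show "integrable (PiM (insert i I) (\<lambda>_. Q)) h \<longleftrightarrow>
       integrable (Q \<Otimes>\<^sub>M PiM I (\<lambda>_. Q)) (\<lambda>z. h ((snd z)(i := fst z)))"
    by (subst eq) (rule integrable_distr_eq[OF m h])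
qed

text \<open>The martingale argument: the coordinate \<open>i\<close> contributes the factor \<open>exp (l\<^sup>2 * v)\<close>, because
  its martingale difference is an average over the other coordinates \<open>y\<close> of differences controlled
  by \<open>exp_moment_Max\<close>, and the average can be taken out of the exponential by Jensen's inequality.\<close>

lemma exp_moment_Max_PiM:
  fixes f :: "'u \<Rightarrow> 'x \<Rightarrow> real" and g :: "'u \<Rightarrow> real" and b v l :: real
  assumes Q: "prob_space Q" and I: "finite I" and F: "finite F" "F \<noteq> {}"
    and meas[measurable]: "\<And>u. u \<in> F \<Longrightarrow> f u \<in> borel_measurable Q"
    and f: "\<And>u x. u \<in> F \<Longrightarrow> 0 \<le> f u x" "\<And>u x. u \<in> F \<Longrightarrow> f u x \<le> b"
    and v: "\<And>u. u \<in> F \<Longrightarrow> (\<integral>x. (f u x)\<^sup>2 \<partial>Q) \<le> v"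
    and l: "0 \<le> l" "l * b \<le> 1"
  shows "(\<integral>y. exp (l * (Max ((\<lambda>u. g u - (\<Sum>i\<in>I. f u (y i))) ` F)
            - (\<integral>y. Max ((\<lambda>u. g u - (\<Sum>i\<in>I. f u (y i))) ` F) \<partial>PiM I (\<lambda>_. Q)))) \<partial>PiM I (\<lambda>_. Q))
         \<le> exp (real (card I) * (l\<^sup>2 * v))"
  using I
proof (induction I arbitrary: g rule: finite_induct)
  case empty
  interpret P0: prob_space "PiM {} (\<lambda>_. Q)" by (intro prob_space_PiM Q)
  show ?case by (simp add: P0.prob_space)
next
  case (insert i I)
  interpret Q: prob_space Q by fact
  define N where "N = PiM I (\<lambda>_. Q)"
  interpret N: prob_space N unfolding N_def by (intro prob_space_PiM Q)
  interpret QN: pair_prob_space Q N ..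
  define s where "s = (\<lambda>u y. \<Sum>j\<in>I. f u (y j))"
  define R where "R = (\<lambda>x y. Max ((\<lambda>u. g u - f u x - s u y) ` F))"
  have s_meas[measurable]: "s u \<in> borel_measurable N" if "u \<in> F" for u
    unfolding s_def N_def using that by measurable
  have R_meas: "(\<lambda>z. R (fst z) (snd z)) \<in> borel_measurable (Q \<Otimes>\<^sub>M N)"
    unfolding R_def
  proof (intro borel_measurable_Max F)
    fix u assume [measurable]: "u \<in> F"
    show "(\<lambda>z. g u - f u (fst z) - s u (snd z)) \<in> borel_measurable (Q \<Otimes>\<^sub>M N)" by measurable
  qed
  then have R_meas2[measurable]: "(\<lambda>(x, y). R x y) \<in> borel_measurable (Q \<Otimes>\<^sub>M N)"
    by (simp add: case_prod_beta')
  have R_measx[measurable]: "(\<lambda>x. R x y) \<in> borel_measurable Q" for y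
    unfolding R_def using F meas by (intro borel_measurable_Max) auto
  have R_measy[measurable]: "(\<lambda>y. R x y) \<in> borel_measurable N" for x
    unfolding R_def using F by (intro borel_measurable_Max) auto
  obtain B where B: "\<And>x y. \<bar>R x y\<bar> \<le> B"
  proof
    fix x y
    have s: "0 \<le> s u y" "s u y \<le> real (card I) * b" if "u \<in> F" for u
      unfolding s_def using f that by (auto intro!: sum_nonneg sum_bounded_above)
    have "\<bar>R x y\<bar> \<le> (\<Sum>u\<in>F. \<bar>g u - f u x - s u y\<bar>)"
      unfolding R_def by (rule abs_Max_image_le_sum[OF F])
    also have "\<dots> \<le> (\<Sum>u\<in>F. \<bar>g u\<bar> + b + real (card I) * b)"
      using f s by (intro sum_mono) (smt (verit))
    finally show "\<bar>R x y\<bar> \<le> (\<Sum>u\<in>F. \<bar>g u\<bar> + b + real (card I) * b)" .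
  qed
  \<comment> \<open>\<open>r\<close> and \<open>q\<close> are the conditional means given coordinate
    \<open>i\<close> and given the other coordinates; \<open>r x - c\<close> is the martingale
    difference of coordinate \<open>i\<close>.\<close>
  define r where "r = (\<lambda>x. \<integral>y. R x y \<partial>N)"
  define q where "q = (\<lambda>y. \<integral>x. R x y \<partial>Q)"
  define c where "c = (\<integral>x. r x \<partial>Q)"
  have iR: "integrable (Q \<Otimes>\<^sub>M N) (\<lambda>(x, y). R x y)"
    by (rule QN.P.integrable_const_bound[of _ B]) (use B in auto)
  have iRx: "integrable Q (\<lambda>x. R x y)" for y by (rule Q.integrable_const_bound[of _ B]) (use B in auto)
  have iRy: "integrable N (R x)" for x by (rule N.integrable_const_bound[of _ B]) (use B in auto)
  have r_meas[measurable]: "r \<in> borel_measurable Q" unfolding r_def by measurable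
  have q_meas[measurable]: "q \<in> borel_measurable N" unfolding q_def by measurable
  have rB: "\<bar>r x\<bar> \<le> B" for x
    unfolding r_def using B iRy[of x]
    by (intro abs_leI N.expectation_mono_const) (auto simp flip: Bochner_Integration.integral_minus
        intro!: N.expectation_mono_const simp: abs_le_iff)
  have qB: "\<bar>q y\<bar> \<le> B" for y
    unfolding q_def using B iRx[of y]
    by (intro abs_leI Q.expectation_mono_const) (auto simp flip: Bochner_Integration.integral_minus
        intro!: Q.expectation_mono_const simp: abs_le_iff)
  have ir: "integrable Q r" by (rule Q.integrable_const_bound[of _ B]) (use rB in auto)
  have iq: "integrable N q" by (rule N.integrable_const_bound[of _ B]) (use qB in auto)
  have cB: "\<bar>c\<bar> \<le> B" unfolding c_def using rB ir
    by (intro abs_leI Q.expectation_mono_const) (auto simp flip: Bochner_Integration.integral_minus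
        intro!: Q.expectation_mono_const simp: abs_le_iff)
  have c_q: "c = (\<integral>y. q y \<partial>N)"
    unfolding c_def r_def q_def using QN.Fubini_integral[OF iR] by simp
  have Z_meas: "(\<lambda>y. Max ((\<lambda>u. g u - (\<Sum>i\<in>insert i I. f u (y i))) ` F))
      \<in> borel_measurable (PiM (insert i I) (\<lambda>_. Q))"
  proof (intro borel_measurable_Max F)
    fix u assume [measurable]: "u \<in> F"
    show "(\<lambda>y. g u - (\<Sum>i\<in>insert i I. f u (y i))) \<in> borel_measurable (PiM (insert i I) (\<lambda>_. Q))" by measurable
  qed
  have Z_upd: "Max ((\<lambda>u. g u - (\<Sum>j\<in>insert i I. f u ((y(i := x)) j))) ` F) = R x y" for x y
  proof -
    have "(\<Sum>j\<in>insert i I. f u ((y(i := x)) j)) = f u x + s u y" for u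
      unfolding s_def using insert.hyps by (simp add: sum.insert cong: sum.cong) (intro sum.cong, auto)
    then show ?thesis by (simp add: R_def algebra_simps)
  qed
  have EZ: "(\<integral>y. Max ((\<lambda>u. g u - (\<Sum>i\<in>insert i I. f u (y i))) ` F) \<partial>PiM (insert i I) (\<lambda>_. Q)) = c"
    unfolding integral_PiM_insert_pair[OF Q Z_meas] Z_upd N_def[symmetric]
    using QN.integral_fst'[OF iR] by (simp add: c_def r_def case_prod_beta')
  have lB: "l * (a - a') \<le> l * (2 * B)" if "\<bar>a\<bar> \<le> B" "\<bar>a'\<bar> \<le> B" for a a'
    using that l by (intro mult_left_mono) auto
  have iE: "integrable (Q \<Otimes>\<^sub>M N) (\<lambda>(x, y). exp (l * (R x y - c)))"
    by (rule QN.P.integrable_const_bound[of _ "exp (l * (2 * B))"]) (use lB[OF B cB] in auto)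
  have "(\<integral>y. exp (l * (Max ((\<lambda>u. g u - (\<Sum>i\<in>insert i I. f u (y i))) ` F) - c)) \<partial>PiM (insert i I) (\<lambda>_. Q))
      = (\<integral>z. exp (l * (R (fst z) (snd z) - c)) \<partial>(Q \<Otimes>\<^sub>M N))"
    by (subst integral_PiM_insert_pair[OF Q])
      (use Z_meas in \<open>simp_all only: Z_upd N_def[symmetric] borel_measurable_exp
         borel_measurable_times borel_measurable_diff borel_measurable_const measurable_compose[OF _ borel_measurable_exp]\<close>)
  also have "\<dots> = (\<integral>x. (\<integral>y. exp (l * (R x y - c)) \<partial>N) \<partial>Q)"
    using QN.integral_fst'[OF iE] by (simp add: case_prod_beta')
  also have "\<dots> = (\<integral>x. exp (l * (r x - c)) * (\<integral>y. exp (l * (R x y - r x)) \<partial>N) \<partial>Q)"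
    by (simp flip: integral_mult_right_zero exp_add distrib_left)
  also have "\<dots> \<le> (\<integral>x. exp (l * (r x - c)) * exp (real (card I) * (l\<^sup>2 * v)) \<partial>Q)"
  proof (rule integral_mono)
    have 1: "(\<lambda>x. \<integral>y. exp (l * (R x y - r x)) \<partial>N) \<in> borel_measurable Q"
      by measurable
    \<comment> \<open>For frozen \<open>x\<close> the summand \<open>- f u x\<close> belongs to the
      offset, which is why the induction keeps \<open>g\<close> arbitrary.\<close>
    have IH: "(\<integral>y. exp (l * (R x y - r x)) \<partial>N) \<le> exp (real (card I) * (l\<^sup>2 * v))" for x
      using insert.IH[of "\<lambda>u. g u - f u x"] unfolding r_def R_def s_def N_def .
    have pos: "0 \<le> (\<integral>y. exp (l * (R x y - r x)) \<partial>N)" for x by simp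
    show "exp (l * (r x - c)) * (\<integral>y. exp (l * (R x y - r x)) \<partial>N)
        \<le> exp (l * (r x - c)) * exp (real (card I) * (l\<^sup>2 * v))" for x
      by (intro mult_left_mono IH) auto
    show "integrable Q (\<lambda>x. exp (l * (r x - c)) * exp (real (card I) * (l\<^sup>2 * v)))"
      by (rule Q.integrable_const_bound[of _ "exp (l * (2*B)) * exp (real (card I) * (l\<^sup>2 * v))"])
        (use lB[OF rB cB] in auto)
    have bd: "exp (l * (r x - c)) * (\<integral>y. exp (l * (R x y - r x)) \<partial>N)
        \<le> exp (l * (2*B)) * exp (real (card I) * (l\<^sup>2 * v))" for x
      by (intro mult_mono IH pos) (use lB[OF rB cB] in auto)
    show "integrable Q (\<lambda>x. exp (l * (r x - c)) * (\<integral>y. exp (l * (R x y - r x)) \<partial>N))"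
      by (rule Q.integrable_const_bound[of _ "exp (l * (2*B)) * exp (real (card I) * (l\<^sup>2 * v))"])
        (use bd 1 in \<open>auto simp: abs_mult\<close>)
  qed
  also have "\<dots> = (\<integral>x. exp (l * (r x - c)) \<partial>Q) * exp (real (card I) * (l\<^sup>2 * v))" by simp
  also have "(\<integral>x. exp (l * (r x - c)) \<partial>Q) \<le> exp (l\<^sup>2 * v)"
  proof -
    have iD: "integrable (Q \<Otimes>\<^sub>M N) (\<lambda>(x, y). exp (l * (R x y - q y)))"
      by (rule QN.P.integrable_const_bound[of _ "exp (l * (2 * B))"]) (use lB[OF B qB] in auto)
    have "(\<integral>x. exp (l * (r x - c)) \<partial>Q) \<le> (\<integral>x. (\<integral>y. exp (l * (R x y - q y)) \<partial>N) \<partial>Q)"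
    proof (rule integral_mono)
      show "integrable Q (\<lambda>x. exp (l * (r x - c)))"
        by (rule Q.integrable_const_bound[of _ "exp (l * (2*B))"]) (use lB[OF rB cB] in auto)
      show "integrable Q (\<lambda>x. \<integral>y. exp (l * (R x y - q y)) \<partial>N)"
        using QN.integrable_fst'[OF iD] by simp
      fix x
      \<comment> \<open>Jensen requires the difference as an average over the same \<open>y\<close>;
        for this \<open>c\<close> is read as the mean of \<open>q\<close> instead of
        \<open>r\<close>.\<close>
      have "l * (r x - c) = (\<integral>y. l * (R x y - q y) \<partial>N)"
        unfolding c_q r_def using iRy[of x] iq by simp
      moreover have "exp (\<integral>y. l * (R x y - q y) \<partial>N) \<le> (\<integral>y. exp (l * (R x y - q y)) \<partial>N)"
      proof (rule N.jensens_inequality[where I=UNIV and q=exp])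
        show "integrable N (\<lambda>y. l * (R x y - q y))" using iRy[of x] iq by simp
        show "integrable N (\<lambda>y. exp (l * (R x y - q y)))"
          by (rule N.integrable_const_bound[of _ "exp (l * (2*B))"]) (use lB[OF B qB] in auto)
        show "convex_on UNIV (exp :: real \<Rightarrow> real)" by (rule exp_convex)
      qed auto
      ultimately show "exp (l * (r x - c)) \<le> (\<integral>y. exp (l * (R x y - q y)) \<partial>N)" by (simp only:)
    qed
    also have "\<dots> = (\<integral>y. (\<integral>x. exp (l * (R x y - q y)) \<partial>Q) \<partial>N)"
      using QN.Fubini_integral[OF iD] by simp
    also have "\<dots> \<le> exp (l\<^sup>2 * v)"
    proof (rule N.expectation_mono_const)
      show "integrable N (\<lambda>y. \<integral>x. exp (l * (R x y - q y)) \<partial>Q)"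
        using QN.integrable_snd[OF iD] by simp
      fix y
      \<comment> \<open>With \<open>y\<close> frozen the roles reverse: \<open>s u y\<close> joins
        the offset and the maximum is a function of the single row \<open>x\<close>.\<close>
      have "R x y = Max ((\<lambda>u. g u - s u y - f u x) ` F)" for x by (simp add: R_def algebra_simps)
      then show "(\<integral>x. exp (l * (R x y - q y)) \<partial>Q) \<le> exp (l\<^sup>2 * v)"
        using Q.exp_moment_Max[OF F meas f v l, where g = "\<lambda>u. g u - s u y"] unfolding q_def by simp
    qed
    finally show ?thesis .
  qed
  finally show ?case
    unfolding EZ using insert.hyps by (simp add: algebra_simps flip: exp_add)
qed

text \<open>The optimal rate is \<open>l = sqrt (t / (n * v))\<close>, cut off at \<open>1 / b\<close>.\<close>

lemma chernoff_rate:
  fixes n v b t :: real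
  assumes "n > 0" "v \<ge> 0" "b > 0" "t > 0"
  obtains l where "l > 0" "l * b \<le> 1" "n * (l\<^sup>2 * v) - l * (2 * sqrt (n * v * t) + b * t) \<le> - t"
proof (cases "t * b\<^sup>2 \<le> n * v")
  case True
  define l where "l = sqrt (t / (n * v))"
  have nv: "n * v > 0" using True assms by (smt (verit) mult_pos_pos zero_less_power)
  then have nvne: "n \<noteq> 0" "v \<noteq> 0" by auto
  have l2: "l\<^sup>2 = t / (n * v)" unfolding l_def using nv assms by simp
  have "(l * b)\<^sup>2 \<le> 1\<^sup>2" using True nv by (simp add: power_mult_distrib l2 field_simps)
  then have lb: "l * b \<le> 1" by (rule power2_le_imp_le) simp
  have l0: "l > 0" unfolding l_def using nv assms by simp
  have "sqrt (n * v * t) * l = sqrt ((n * v * t) * (t / (n * v)))"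
    unfolding l_def by (rule real_sqrt_mult[symmetric])
  also have "(n * v * t) * (t / (n * v)) = t\<^sup>2" using nvne by (simp add: power2_eq_square)
  finally have sl: "sqrt (n * v * t) * l = t" using assms by simp
  have "n * (l\<^sup>2 * v) = t" using nvne by (simp add: l2)
  moreover have "l * (2 * sqrt (n * v * t) + b * t) = 2 * t + l * b * t"
    using sl by (simp add: algebra_simps)
  moreover have "0 \<le> l * b * t" using l0 assms by simp
  ultimately have "n * (l\<^sup>2 * v) - l * (2 * sqrt (n * v * t) + b * t) \<le> - t" by linarith
  with that l0 lb show thesis by blast
next
  case False
  define l where "l = 1 / b"
  \<comment> \<open>Here \<open>sqrt (n * v)\<close> is below \<open>b * sqrt t\<close>. One more
    factor \<open>sqrt (n * v)\<close> charges the quadratic term to one of the two copies of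
    \<open>sqrt (n * v * t) * l\<close>; the summand \<open>b * t\<close> then yields the full
    \<open>t\<close>, as \<open>l * b = 1\<close>.\<close>
  have "sqrt (n * v) * sqrt (n * v) \<le> sqrt (n * v) * sqrt (t * b\<^sup>2)"
    using False assms by (intro mult_left_mono) auto
  also have "\<dots> = sqrt (n * v * t) * b" using assms by (simp add: real_sqrt_mult)
  finally have "n * v \<le> sqrt (n * v * t) * b" using assms by simp
  then have "n * v * l\<^sup>2 \<le> sqrt (n * v * t) * b * l\<^sup>2" by (intro mult_right_mono) auto
  also have "\<dots> = sqrt (n * v * t) * l" using assms by (simp add: l_def power2_eq_square)
  finally have 1: "n * (l\<^sup>2 * v) \<le> sqrt (n * v * t) * l" by (simp add: algebra_simps)
  have "0 \<le> sqrt (n * v * t) * l" using assms by (simp add: l_def)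
  moreover have "l * (2 * sqrt (n * v * t) + b * t) = 2 * (sqrt (n * v * t) * l) + t"
    using assms by (simp add: l_def field_simps)
  ultimately have "n * (l\<^sup>2 * v) - l * (2 * sqrt (n * v * t) + b * t) \<le> - t" using 1 by linarith
  moreover have "l > 0" "l * b \<le> 1" using assms by (auto simp: l_def)
  ultimately show thesis using that by blast
qed

lemma Max_PiM_tail:
  fixes f :: "'u \<Rightarrow> 'x \<Rightarrow> real" and g :: "'u \<Rightarrow> real" and b v t :: real
  assumes Q: "prob_space Q" and I: "finite I" "I \<noteq> {}" and F: "finite F" "F \<noteq> {}"
    and meas[measurable]: "\<And>u. u \<in> F \<Longrightarrow> f u \<in> borel_measurable Q"
    and f: "\<And>u x. u \<in> F \<Longrightarrow> 0 \<le> f u x" "\<And>u x. u \<in> F \<Longrightarrow> f u x \<le> b"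
    and v: "\<And>u. u \<in> F \<Longrightarrow> (\<integral>x. (f u x)\<^sup>2 \<partial>Q) \<le> v"
    and b: "b > 0" and t: "t > 0"
  defines "Z \<equiv> \<lambda>y. Max ((\<lambda>u. g u - (\<Sum>i\<in>I. f u (y i))) ` F)"
    and "N \<equiv> PiM I (\<lambda>_. Q)"
  shows "measure N {y \<in> space N. Z y \<ge> (\<integral>y. Z y \<partial>N) + 2 * sqrt (card I * v * t) + b * t} \<le> exp (- t)"
proof -
  interpret N: prob_space N unfolding N_def by (intro prob_space_PiM Q)
  obtain u where "u \<in> F" using F by auto
  have "0 \<le> (\<integral>x. (f u x)\<^sup>2 \<partial>Q)" by simp
  with v[OF \<open>u \<in> F\<close>] have v0: "0 \<le> v" by linarith
  have n: "0 < real (card I)" using I by (simp add: card_gt_0_iff)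
  obtain l :: real where l: "l > 0" "l * b \<le> 1"
    "card I * (l\<^sup>2 * v) - l * (2 * sqrt (card I * v * t) + b * t) \<le> - t"
    by (rule chernoff_rate[where n = "real (card I)" and v = v and b = b and t = t])
      (use n v0 b t in auto)
  let ?c = "\<integral>y. Z y \<partial>N"
  let ?d = "2 * sqrt (card I * v * t) + b * t"
  have Z_meas[measurable]: "Z \<in> borel_measurable N"
    unfolding Z_def N_def
  proof (intro borel_measurable_Max F)
    fix u assume [measurable]: "u \<in> F"
    show "(\<lambda>y. g u - (\<Sum>i\<in>I. f u (y i))) \<in> borel_measurable (PiM I (\<lambda>_. Q))" by measurable
  qed
  have s: "0 \<le> (\<Sum>i\<in>I. f u (y i))" if "u \<in> F" for u y using f that by (auto intro!: sum_nonneg)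
  \<comment> \<open>As \<open>l > 0\<close>, an upper bound on \<open>Z\<close> dominates the
    exponential, and \<open>f \<ge> 0\<close> gives one.\<close>
  have ZB: "Z y \<le> (\<Sum>u\<in>F. \<bar>g u\<bar>)" for y
  proof -
    have "g u - (\<Sum>i\<in>I. f u (y i)) \<le> (\<Sum>u\<in>F. \<bar>g u\<bar>)" if "u \<in> F" for u
      using member_le_sum[OF that, of "\<lambda>u. \<bar>g u\<bar>"] F s[OF that, of y] by auto
    then show ?thesis unfolding Z_def using F by (intro Max.boundedI) auto
  qed
  have int: "integrable N (\<lambda>y. exp (l * (Z y - ?c)))"
    by (rule N.integrable_const_bound[of _ "exp (l * ((\<Sum>u\<in>F. \<bar>g u\<bar>) - ?c))"]) (use ZB l in auto)
  have "measure N {y \<in> space N. Z y \<ge> ?c + 2 * sqrt (card I * v * t) + b * t}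
      \<le> measure N {y \<in> space N. exp (l * (Z y - ?c)) \<ge> exp (l * ?d)}"
    using l by (intro N.finite_measure_mono) (auto intro!: mult_left_mono)
  also have "\<dots> \<le> (\<integral>y. exp (l * (Z y - ?c)) \<partial>N) / exp (l * ?d)"
    by (rule integral_Markov_inequality_measure[OF int]) auto
  also have "\<dots> \<le> exp (card I * (l\<^sup>2 * v)) / exp (l * ?d)"
    using exp_moment_Max_PiM[OF Q I(1) F meas f v less_imp_le[OF l(1)] l(2), where g = g]
    unfolding Z_def N_def by (intro divide_right_mono) auto
  also have "\<dots> = exp (card I * (l\<^sup>2 * v) - l * ?d)" by (simp add: exp_diff)
  also have "\<dots> \<le> exp (- t)" using l by simp
  finally show ?thesis .
qed

section \<open>Symmetrization and contraction\<close>

text \<open>The law of a row multiplied by an independent fair sign. Absorbing the sign into the law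
  of the row keeps the symmetrized sample an i.i.d. product, so that no separate vector of signs has
  to be carried along.\<close>

definition symmetrize :: "'x::euclidean_space measure \<Rightarrow> 'x measure" where
  "symmetrize Q = distr (Q \<Otimes>\<^sub>M measure_pmf (pmf_of_set {1, - 1 :: real})) borel (\<lambda>z. snd z *\<^sub>R fst z)"

lemma sets_symmetrize[simp, measurable_cong]: "sets (symmetrize Q) = sets borel"
  and space_symmetrize[simp]: "space (symmetrize Q) = UNIV"
  by (simp_all add: symmetrize_def)

lemma measurable_sign_scaleR:
  fixes Q :: "'x::euclidean_space measure"
  assumes [measurable_cong]: "sets Q = sets borel"
  shows "(\<lambda>z. snd z *\<^sub>R fst z) \<in> Q \<Otimes>\<^sub>M measure_pmf (S :: real pmf) \<rightarrow>\<^sub>M borel"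
proof -
  \<comment> \<open>\<open>measure_pmf\<close> carries the discrete sigma-algebra, so both factors
    are first mapped into \<open>borel\<close>, where scaling is measurable.\<close>
  have [measurable]: "(\<lambda>x. x) \<in> measure_pmf S \<rightarrow>\<^sub>M borel" by simp
  have [measurable]: "(\<lambda>x. x) \<in> Q \<rightarrow>\<^sub>M borel" by measurable
  have "(\<lambda>z. (\<lambda>x. x) (snd z) *\<^sub>R (\<lambda>x. x) (fst z)) \<in> Q \<Otimes>\<^sub>M measure_pmf S \<rightarrow>\<^sub>M borel"
    by (intro borel_measurable_scaleR measurable_compose[OF measurable_snd] measurable_compose[OF measurable_fst]) measurable
  then show ?thesis by simp
qed

lemma prob_space_symmetrize:
  assumes "prob_space Q" "sets Q = sets borel"
  shows "prob_space (symmetrize Q)"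
proof -
  interpret Q: prob_space Q by fact
  interpret S: prob_space "measure_pmf (pmf_of_set {1, - 1 :: real})" by (rule prob_space_measure_pmf)
  interpret QS: pair_prob_space Q "measure_pmf (pmf_of_set {1, - 1 :: real})" ..
  show ?thesis unfolding symmetrize_def
    by (rule QS.P.prob_space_distr) (rule measurable_sign_scaleR[OF assms(2)])
qed

lemma
  fixes h :: "'x::euclidean_space \<Rightarrow> real"
  assumes Q: "prob_space Q" "sets Q = sets borel"
    and h: "integrable Q h" "integrable Q (\<lambda>x. h (- x))"
  shows integrable_symmetrize: "integrable (symmetrize Q) h"
    and integral_symmetrize: "(\<integral>x. h x \<partial>symmetrize Q) = ((\<integral>x. h x \<partial>Q) + (\<integral>x. h (- x) \<partial>Q)) / 2"
proof -
  interpret Q: prob_space Q by fact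
  define S where "S = measure_pmf (pmf_of_set {1, - 1 :: real})"
  interpret S: prob_space S unfolding S_def by (rule prob_space_measure_pmf)
  interpret QS: pair_prob_space Q S ..
  have hb: "h \<in> borel_measurable borel"
    using borel_measurable_integrable[OF h(1)] measurable_cong_sets[OF Q(2) refl] by blast
  have m: "(\<lambda>z. snd z *\<^sub>R fst z) \<in> Q \<Otimes>\<^sub>M S \<rightarrow>\<^sub>M borel"
    unfolding S_def by (rule measurable_sign_scaleR[OF Q(2)])
  have S_int: "(\<integral>s. k s \<partial>S) = (k 1 + k (-1)) / 2" for k :: "real \<Rightarrow> real"
    unfolding S_def by (subst integral_pmf_of_set) (auto simp: card_insert_if)
  have S_fin: "integrable S k" for k :: "real \<Rightarrow> real"
    unfolding S_def by (rule integrable_measure_pmf_finite) simp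
  have int: "integrable (Q \<Otimes>\<^sub>M S) (\<lambda>z. h (snd z *\<^sub>R fst z))"
  proof (rule QS.Fubini_integrable)
    show "(\<lambda>z. h (snd z *\<^sub>R fst z)) \<in> borel_measurable (Q \<Otimes>\<^sub>M S)" by (rule measurable_compose[OF m hb])
    show "integrable Q (\<lambda>x. \<integral>s. norm (h (snd (x, s) *\<^sub>R fst (x, s))) \<partial>S)"
      using h by (simp add: S_int)
  qed (simp add: S_fin)
  show "integrable (symmetrize Q) h"
    unfolding symmetrize_def S_def[symmetric] using int by (subst integrable_distr_eq[OF m hb])
  have "(\<integral>x. h x \<partial>symmetrize Q) = (\<integral>z. h (snd z *\<^sub>R fst z) \<partial>(Q \<Otimes>\<^sub>M S))"
    unfolding symmetrize_def S_def[symmetric] by (rule integral_distr[OF m hb])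
  also have "\<dots> = (\<integral>x. (\<integral>s. h (s *\<^sub>R x) \<partial>S) \<partial>Q)"
    using QS.integral_fst'[OF int] by simp
  also have "\<dots> = ((\<integral>x. h x \<partial>Q) + (\<integral>x. h (- x) \<partial>Q)) / 2"
    using h by (simp add: S_int)
  finally show "(\<integral>x. h x \<partial>symmetrize Q) = ((\<integral>x. h x \<partial>Q) + (\<integral>x. h (- x) \<partial>Q)) / 2" .
qed

text \<open>The two-point case of the contraction principle. For maximizers \<open>u\<close> and
  \<open>w\<close> of the two maxima on the left, the left-hand side is at most
  \<open>g u + g w + \<bar>s u - s w\<bar>\<close>, and the sign of \<open>s u - s w\<close> decides
  which of the two receives \<open>+ s\<close> on the right. As no absolute values surround the
  processes, no factor is lost.\<close>

lemma Max_contraction: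
  fixes g f s :: "'u \<Rightarrow> real"
  assumes F: "finite F" "F \<noteq> {}"
    and lip: "\<And>u w. u \<in> F \<Longrightarrow> w \<in> F \<Longrightarrow> \<bar>f u - f w\<bar> \<le> \<bar>s u - s w\<bar>"
  shows "Max ((\<lambda>u. g u + f u) ` F) + Max ((\<lambda>u. g u - f u) ` F)
       \<le> Max ((\<lambda>u. g u + s u) ` F) + Max ((\<lambda>u. g u - s u) ` F)"
proof -
  have "Max (a ` F) \<in> a ` F" for a :: "'u \<Rightarrow> real" using F by (intro Max_in) auto
  then have "\<exists>u\<in>F. Max (a ` F) = a u" for a :: "'u \<Rightarrow> real" by auto
  note ex = this
  obtain u where u: "u \<in> F" "Max ((\<lambda>u. g u + f u) ` F) = g u + f u"
    using ex[of "\<lambda>u. g u + f u"] by blast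
  obtain w where w: "w \<in> F" "Max ((\<lambda>u. g u - f u) ` F) = g w - f w"
    using ex[of "\<lambda>u. g u - f u"] by blast
  have le: "a v \<le> Max (a ` F)" if "v \<in> F" for a :: "'u \<Rightarrow> real" and v using that F by auto
  show ?thesis
    using u w lip[OF u(1) w(1)] le[OF u(1), of "\<lambda>u. g u + s u"] le[OF w(1), of "\<lambda>u. g u + s u"]
      le[OF u(1), of "\<lambda>u. g u - s u"] le[OF w(1), of "\<lambda>u. g u - s u"] by linarith
qed

text \<open>Symmetrization of one row by convexity: \<open>g u + (E f - f)\<close> is the midpoint
  of \<open>g u + 2 * E f\<close> and \<open>g u - 2 * f\<close>, and the maximum of the former is
  at most the mean of the maximum of \<open>g u + 2 * f\<close>. This doubling is the factor 2 in
  \<open>2 * L\<close>. Contraction then acts for each fixed \<open>x\<close>, and averaging over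
  \<open>x\<close> and \<open>- x\<close> produces \<open>symmetrize Q\<close>.\<close>

lemma expectation_Max_le_symmetrize:
  fixes Q :: "'x::euclidean_space measure" and g :: "'x \<Rightarrow> real" and f :: "'x \<Rightarrow> 'x \<Rightarrow> real"
  assumes Q: "prob_space Q" "sets Q = sets borel" and F: "finite F" "F \<noteq> {}"
    and intf: "\<And>u. u \<in> F \<Longrightarrow> integrable Q (f u)"
    and intx: "\<And>u. u \<in> F \<Longrightarrow> integrable Q (\<lambda>x. x \<bullet> u)"
    and lip: "\<And>u w x. u \<in> F \<Longrightarrow> w \<in> F \<Longrightarrow> \<bar>f u x - f w x\<bar> \<le> L * \<bar>x \<bullet> u - x \<bullet> w\<bar>"
  shows "(\<integral>x. Max ((\<lambda>u. g u + ((\<integral>x. f u x \<partial>Q) - f u x)) ` F) \<partial>Q)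
       \<le> (\<integral>x. Max ((\<lambda>u. g u + 2 * L * (x \<bullet> u)) ` F) \<partial>symmetrize Q)"
proof -
  interpret Q: prob_space Q by fact
  let ?A = "\<lambda>x. Max ((\<lambda>u. g u + 2 * f u x) ` F)" and ?B = "\<lambda>x. Max ((\<lambda>u. g u - 2 * f u x) ` F)"
  let ?C = "\<lambda>x. Max ((\<lambda>u. g u + 2 * L * (x \<bullet> u)) ` F)"
  have le: "a v \<le> Max (a ` F)" if "v \<in> F" for a :: "'x \<Rightarrow> real" and v using that F by auto
  have iA: "integrable Q ?A" and iB: "integrable Q ?B"
    using intf by (intro integrable_Max_image F; simp)+
  have iC: "integrable Q ?C" and iC': "integrable Q (\<lambda>x. ?C (- x))"
    using intx by (intro integrable_Max_image F; simp)+
  have "Max ((\<lambda>u. g u + ((\<integral>x. f u x \<partial>Q) - f u x)) ` F) \<le> ((\<integral>x. ?A x \<partial>Q) + ?B x) / 2" for x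
  proof (rule Max.boundedI)
    fix z assume "z \<in> (\<lambda>u. g u + ((\<integral>x. f u x \<partial>Q) - f u x)) ` F"
    then obtain u where u: "u \<in> F" "z = g u + ((\<integral>x. f u x \<partial>Q) - f u x)" by auto
    have "g u + 2 * (\<integral>x. f u x \<partial>Q) = (\<integral>x. g u + 2 * f u x \<partial>Q)"
      using intf[OF u(1)] by (simp add: Q.prob_space)
    also have "\<dots> \<le> (\<integral>x. ?A x \<partial>Q)"
      using intf[OF u(1)] iA le[OF u(1)] by (intro integral_mono) auto
    finally show "z \<le> ((\<integral>x. ?A x \<partial>Q) + ?B x) / 2"
      using le[OF u(1), of "\<lambda>u. g u - 2 * f u x"] u(2) by simp
  qed (use F in auto)
  then have "(\<integral>x. Max ((\<lambda>u. g u + ((\<integral>x. f u x \<partial>Q) - f u x)) ` F) \<partial>Q) \<le> (\<integral>x. ((\<integral>x. ?A x \<partial>Q) + ?B x) / 2 \<partial>Q)"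
    using iB intf by (intro integral_mono integrable_Max_image F) auto
  also have "\<dots> = (\<integral>x. ?A x + ?B x \<partial>Q) / 2"
    using iA iB by (simp add: Q.prob_space)
  also have "\<dots> \<le> (\<integral>x. ?C x + ?C (- x) \<partial>Q) / 2"
  proof (intro divide_right_mono integral_mono)
    fix x
    have "\<bar>2 * f u x - 2 * f w x\<bar> \<le> \<bar>2 * L * (x \<bullet> u) - 2 * L * (x \<bullet> w)\<bar>" if "u \<in> F" "w \<in> F" for u w
    proof -
      have "\<bar>2 * f u x - 2 * f w x\<bar> = 2 * \<bar>f u x - f w x\<bar>" using abs_mult[of 2 "f u x - f w x"] by (simp add: right_diff_distrib)
      also have "\<dots> \<le> 2 * (L * \<bar>x \<bullet> u - x \<bullet> w\<bar>)" using lip[OF that] by simp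
      also have "\<dots> \<le> \<bar>2 * L * (x \<bullet> u - x \<bullet> w)\<bar>" by (simp add: abs_mult mult_right_mono)
      finally show ?thesis by (simp add: right_diff_distrib)
    qed
    then show "?A x + ?B x \<le> ?C x + ?C (- x)"
      using Max_contraction[OF F, of "\<lambda>u. 2 * f u x" "\<lambda>u. 2 * L * (x \<bullet> u)" g] by simp
  qed (use iA iB iC iC' in auto)
  also have "\<dots> = (\<integral>x. ?C x \<partial>symmetrize Q)"
    using integral_symmetrize[OF Q iC iC'] iC iC' by simp
  finally show ?thesis .
qed

section \<open>Integration over product measures, one coordinate at a time\<close>

lemma integrable_pair_add:
  fixes h :: "'x \<Rightarrow> real" and k :: "'y \<Rightarrow> real"
  assumes "prob_space M" "prob_space N" "integrable M h" "integrable N k"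
  shows "integrable (M \<Otimes>\<^sub>M N) (\<lambda>z. h (fst z) + k (snd z))"
proof -
  interpret M: prob_space M by fact
  interpret N: prob_space N by fact
  interpret NM: pair_prob_space N M ..
  have "integrable (M \<Otimes>\<^sub>M N) (\<lambda>z. h (fst z))"
    using assms(3) N.distr_pair_fst[of M] integrable_distr[OF measurable_fst, of M N h] by simp
  moreover have "integrable (N \<Otimes>\<^sub>M M) (\<lambda>z. k (fst z))"
    using assms(4) M.distr_pair_fst[of N] integrable_distr[OF measurable_fst, of N M k] by simp
  then have "integrable (M \<Otimes>\<^sub>M N) (\<lambda>z. k (snd z))"
    using NM.integrable_product_swap[of "\<lambda>z. k (fst z)"] by (simp add: case_prod_beta')
  ultimately show ?thesis by simp
qed

lemma
  fixes h :: "'x \<Rightarrow> real"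
  assumes "prob_space Q" "i \<in> I" "integrable Q h"
  shows integrable_PiM_component: "integrable (PiM I (\<lambda>_. Q)) (\<lambda>y. h (y i))"
    and integral_PiM_component: "(\<integral>y. h (y i) \<partial>PiM I (\<lambda>_. Q)) = (\<integral>x. h x \<partial>Q)"
proof -
  have d: "distr (PiM I (\<lambda>_. Q)) Q (\<lambda>y. y i) = Q"
    using distr_PiM_component[of I "\<lambda>_. Q" i] assms by simp
  have m: "(\<lambda>y. y i) \<in> PiM I (\<lambda>_. Q) \<rightarrow>\<^sub>M Q" using assms(2) by measurable
  show "integrable (PiM I (\<lambda>_. Q)) (\<lambda>y. h (y i))"
    using integrable_distr[OF m, of h] d assms(3) by simp
  show "(\<integral>y. h (y i) \<partial>PiM I (\<lambda>_. Q)) = (\<integral>x. h x \<partial>Q)"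
    using integral_distr[OF m, of h] d assms(3) by simp
qed

lemma integral_PiM_insert_Fubini:
  fixes h :: "('i \<Rightarrow> 'x) \<Rightarrow> real"
  assumes Q: "prob_space Q" and h: "integrable (PiM (insert i I) (\<lambda>_. Q)) h"
  shows "integrable (Q \<Otimes>\<^sub>M PiM I (\<lambda>_. Q)) (\<lambda>(x, y). h (y(i := x)))"
    and "(\<integral>y. h y \<partial>PiM (insert i I) (\<lambda>_. Q)) = (\<integral>x. (\<integral>y. h (y(i := x)) \<partial>PiM I (\<lambda>_. Q)) \<partial>Q)"
    and "(\<integral>y. h y \<partial>PiM (insert i I) (\<lambda>_. Q)) = (\<integral>y. (\<integral>x. h (y(i := x)) \<partial>Q) \<partial>PiM I (\<lambda>_. Q))"
proof -
  interpret Q: prob_space Q by fact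
  interpret N: prob_space "PiM I (\<lambda>_. Q)" by (intro prob_space_PiM Q)
  interpret QN: pair_prob_space Q "PiM I (\<lambda>_. Q)" ..
  have m: "h \<in> borel_measurable (PiM (insert i I) (\<lambda>_. Q))" using h by auto
  have int: "integrable (Q \<Otimes>\<^sub>M PiM I (\<lambda>_. Q)) (\<lambda>z. h ((snd z)(i := fst z)))"
    using h integrable_PiM_insert_pair[OF Q m] by simp
  then show 1: "integrable (Q \<Otimes>\<^sub>M PiM I (\<lambda>_. Q)) (\<lambda>(x, y). h (y(i := x)))"
    by (simp add: case_prod_beta')
  show 2: "(\<integral>y. h y \<partial>PiM (insert i I) (\<lambda>_. Q)) = (\<integral>x. (\<integral>y. h (y(i := x)) \<partial>PiM I (\<lambda>_. Q)) \<partial>Q)"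
    using integral_PiM_insert_pair[OF Q m] QN.integral_fst'[OF int] by simp
  show "(\<integral>y. h y \<partial>PiM (insert i I) (\<lambda>_. Q)) = (\<integral>y. (\<integral>x. h (y(i := x)) \<partial>Q) \<partial>PiM I (\<lambda>_. Q))"
    unfolding 2 using QN.Fubini_integral[OF 1] by simp
qed

lemma integrable_Max_PiM:
  fixes a :: "'u \<Rightarrow> 'x \<Rightarrow> real"
  assumes "prob_space M" "finite F" "F \<noteq> {}" "\<And>u. u \<in> F \<Longrightarrow> integrable M (a u)"
  shows "integrable (PiM I (\<lambda>_. M)) (\<lambda>y. Max ((\<lambda>u. g u + (\<Sum>i\<in>I. a u (y i))) ` F))"
proof -
  interpret N: prob_space "PiM I (\<lambda>_. M)" by (intro prob_space_PiM assms)
  have "integrable (PiM I (\<lambda>_. M)) (\<lambda>y. \<Sum>i\<in>I. a u (y i))" if "u \<in> F" for u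
    by (rule Bochner_Integration.integrable_sum) (rule integrable_PiM_component[OF assms(1) _ assms(4)[OF that]])
  then show ?thesis using assms(2,3) by (intro integrable_Max_image) auto
qed

text \<open>A replacement argument: the coordinates pass from the law \<open>M\<close> to the law
  \<open>N\<close> one after the other. Since \<open>step\<close> holds for every offset, the
  remaining coordinates can be frozen into \<open>g\<close>.\<close>

lemma expectation_Max_PiM_mono:
  fixes a :: "'u \<Rightarrow> 'x \<Rightarrow> real" and d :: "'u \<Rightarrow> 'y \<Rightarrow> real"
  assumes M: "prob_space M" and N: "prob_space N" and F: "finite F" "F \<noteq> {}" and I: "finite I"
    and a: "\<And>u. u \<in> F \<Longrightarrow> integrable M (a u)" and d: "\<And>u. u \<in> F \<Longrightarrow> integrable N (d u)"
    and step: "\<And>g :: 'u \<Rightarrow> real. (\<integral>x. Max ((\<lambda>u. g u + a u x) ` F) \<partial>M) \<le> (\<integral>x. Max ((\<lambda>u. g u + d u x) ` F) \<partial>N)"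
  shows "(\<integral>y. Max ((\<lambda>u. g u + (\<Sum>i\<in>I. a u (y i))) ` F) \<partial>PiM I (\<lambda>_. M))
       \<le> (\<integral>y. Max ((\<lambda>u. g u + (\<Sum>i\<in>I. d u (y i))) ` F) \<partial>PiM I (\<lambda>_. N))"
  using I
proof (induction I arbitrary: g rule: finite_induct)
  case empty
  interpret M0: prob_space "PiM {} (\<lambda>_. M)" by (intro prob_space_PiM M)
  interpret N0: prob_space "PiM {} (\<lambda>_. N)" by (intro prob_space_PiM N)
  show ?case by (simp add: M0.prob_space N0.prob_space)
next
  case (insert i I)
  interpret M: prob_space M by fact
  interpret N: prob_space N by fact
  define MI where "MI = PiM I (\<lambda>_. M)"
  define NI where "NI = PiM I (\<lambda>_. N)"
  interpret MI: prob_space MI unfolding MI_def by (intro prob_space_PiM M)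
  interpret NI: prob_space NI unfolding NI_def by (intro prob_space_PiM N)
  interpret MMI: pair_prob_space M MI ..
  interpret MNI: pair_prob_space M NI ..
  interpret NNI: pair_prob_space N NI ..
  let ?A = "\<lambda>y. Max ((\<lambda>u. g u + (\<Sum>i\<in>insert i I. a u (y i))) ` F)"
  let ?D = "\<lambda>y. Max ((\<lambda>u. g u + (\<Sum>i\<in>insert i I. d u (y i))) ` F)"
  have upd: "(\<Sum>j\<in>insert i I. b ((y(i := x)) j)) = b x + (\<Sum>j\<in>I. b (y j))"
    for b :: "'z \<Rightarrow> real" and x y
    using insert.hyps by (simp add: sum.insert) (intro sum.cong, auto)
  note FA = integral_PiM_insert_Fubini[OF M integrable_Max_PiM[OF M F a, where I = "insert i I" and g = g],
      folded MI_def, unfolded upd]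
  note FD = integral_PiM_insert_Fubini[OF N integrable_Max_PiM[OF N F d, where I = "insert i I" and g = g],
      folded NI_def, unfolded upd]
  \<comment> \<open>The hybrid product: coordinate \<open>i\<close> still follows \<open>M\<close>
    while those in \<open>I\<close> already follow \<open>N\<close>. Between the two replacements
    the order of integration is exchanged on it.\<close>
  have iX: "integrable (M \<Otimes>\<^sub>M NI) (\<lambda>(x, y). Max ((\<lambda>u. g u + (a u x + (\<Sum>j\<in>I. d u (y j)))) ` F))"
    unfolding case_prod_beta'
    by (intro integrable_Max_image F Bochner_Integration.integrable_add[OF MNI.P.integrable_const]
        integrable_pair_add[OF M.prob_space_axioms NI.prob_space_axioms a]
        Bochner_Integration.integrable_sum) (auto simp: NI_def intro!: integrable_PiM_component N d)
  have "integral\<^sup>L (PiM (insert i I) (\<lambda>_. M)) ?A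
      = (\<integral>x. (\<integral>y. Max ((\<lambda>u. g u + (a u x + (\<Sum>j\<in>I. a u (y j)))) ` F) \<partial>MI) \<partial>M)"
    using FA(2) by simp
  also have "\<dots> \<le> (\<integral>x. (\<integral>y. Max ((\<lambda>u. g u + (a u x + (\<Sum>j\<in>I. d u (y j)))) ` F) \<partial>NI) \<partial>M)"
  proof (rule integral_mono)
    show "integrable M (\<lambda>x. \<integral>y. Max ((\<lambda>u. g u + (a u x + (\<Sum>j\<in>I. a u (y j)))) ` F) \<partial>MI)"
      using MMI.integrable_fst'[OF FA(1)] by simp
    show "integrable M (\<lambda>x. \<integral>y. Max ((\<lambda>u. g u + (a u x + (\<Sum>j\<in>I. d u (y j)))) ` F) \<partial>NI)"
      using MNI.integrable_fst'[OF iX] by simp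
    show "(\<integral>y. Max ((\<lambda>u. g u + (a u x + (\<Sum>j\<in>I. a u (y j)))) ` F) \<partial>MI)
        \<le> (\<integral>y. Max ((\<lambda>u. g u + (a u x + (\<Sum>j\<in>I. d u (y j)))) ` F) \<partial>NI)" for x
      using insert.IH[of "\<lambda>u. g u + a u x"] by (simp add: MI_def NI_def add.assoc)
  qed
  also have "\<dots> = (\<integral>y. (\<integral>x. Max ((\<lambda>u. g u + (a u x + (\<Sum>j\<in>I. d u (y j)))) ` F) \<partial>M) \<partial>NI)"
    using MNI.Fubini_integral[OF iX] by simp
  also have "\<dots> \<le> (\<integral>y. (\<integral>x. Max ((\<lambda>u. g u + (d u x + (\<Sum>j\<in>I. d u (y j)))) ` F) \<partial>N) \<partial>NI)"
  proof (rule integral_mono)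
    show "integrable NI (\<lambda>y. \<integral>x. Max ((\<lambda>u. g u + (a u x + (\<Sum>j\<in>I. d u (y j)))) ` F) \<partial>M)"
      using MNI.integrable_snd[OF iX] by simp
    show "integrable NI (\<lambda>y. \<integral>x. Max ((\<lambda>u. g u + (d u x + (\<Sum>j\<in>I. d u (y j)))) ` F) \<partial>N)"
      using NNI.integrable_snd[OF FD(1)] by simp
    show "(\<integral>x. Max ((\<lambda>u. g u + (a u x + (\<Sum>j\<in>I. d u (y j)))) ` F) \<partial>M)
        \<le> (\<integral>x. Max ((\<lambda>u. g u + (d u x + (\<Sum>j\<in>I. d u (y j)))) ` F) \<partial>N)" for y
      using step[of "\<lambda>u. g u + (\<Sum>j\<in>I. d u (y j))"] by (simp add: algebra_simps)
  qed
  also have "\<dots> = integral\<^sup>L (PiM (insert i I) (\<lambda>_. N)) ?D"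
    using FD(3) by simp
  finally show ?case .
qed

section \<open>Maxima of linear functionals\<close>

text \<open>Gram-Schmidt for a form that may be degenerate: an orthonormal family of greatest
  cardinality cannot be extended by a normalized residual, so every residual is null for
  \<open>B\<close>. The residual itself need not vanish, and \<open>V\<close> may have fewer than
  \<open>DIM('x)\<close> elements.\<close>

lemma exists_orthonormal_family:
  fixes B :: "'x::euclidean_space \<Rightarrow> 'x \<Rightarrow> real"
  assumes bil: "bilinear B" and sym: "\<And>u v. B u v = B v u" and pos: "\<And>u. 0 \<le> B u u"
  obtains V where "finite V" "card V \<le> DIM('x)"
    "\<And>v w. v \<in> V \<Longrightarrow> w \<in> V \<Longrightarrow> B v w = (if v = w then 1 else 0)"
    "\<And>u. B (u - (\<Sum>v\<in>V. B u v *\<^sub>R v)) (u - (\<Sum>v\<in>V. B u v *\<^sub>R v)) = 0"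
proof -
  define P where "P = (\<lambda>V. finite V \<and> (\<forall>v\<in>V. \<forall>w\<in>V. B v w = (if v = w then 1 else 0)))"
  have sumB: "B (\<Sum>v\<in>V. c v *\<^sub>R v) w = (\<Sum>v\<in>V. c v * B v w)" for V c w
    using bil linear_sum[of "\<lambda>u. B u w" "\<lambda>v. c v *\<^sub>R v" V] by (simp add: bilinear_def bilinear_lmul[OF bil])
  have card: "card V \<le> DIM('x)" if "P V" for V
  proof -
    have "c w = 0" if "w \<in> V" "(\<Sum>v\<in>V. c v *\<^sub>R v) = 0" for c w
    proof -
      have "0 = B (\<Sum>v\<in>V. c v *\<^sub>R v) w" using that(2) bil by (simp add: bilinear_lzero)
      also have "\<dots> = (\<Sum>v\<in>V. c v * (if v = w then 1 else 0))"
        unfolding sumB using \<open>P V\<close> that(1) by (intro sum.cong) (auto simp: P_def)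
      also have "\<dots> = c w" using \<open>P V\<close> that(1) by (simp add: P_def if_distrib cong: if_cong)
      finally show ?thesis by simp
    qed
    then have "independent V" using \<open>P V\<close> by (subst independent_if_scalars_zero) (auto simp: P_def)
    then show ?thesis using independent_bound by blast
  qed
  have "P {}" by (simp add: P_def)
  then obtain V where V: "P V" and max: "\<And>W. P W \<Longrightarrow> card W \<le> card V"
    using ex_has_greatest_nat[of P "{}" card "Suc DIM('x)"] card by (metis less_Suc_eq_le)
  have "B (u - (\<Sum>v\<in>V. B u v *\<^sub>R v)) (u - (\<Sum>v\<in>V. B u v *\<^sub>R v)) = 0" for u
  proof (rule ccontr)
    define w where "w = u - (\<Sum>v\<in>V. B u v *\<^sub>R v)"
    assume "B (u - (\<Sum>v\<in>V. B u v *\<^sub>R v)) (u - (\<Sum>v\<in>V. B u v *\<^sub>R v)) \<noteq> 0"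
    then have w: "0 < B w w" using pos[of w] by (simp add: w_def)
    have orth: "B w v = 0" if "v \<in> V" for v
    proof -
      have "B w v = B u v - (\<Sum>v'\<in>V. B u v' * B v' v)"
        unfolding w_def by (simp add: bilinear_lsub[OF bil] sumB)
      also have "(\<Sum>v'\<in>V. B u v' * B v' v) = (\<Sum>v'\<in>V. B u v' * (if v' = v then 1 else 0))"
        using V that by (intro sum.cong) (auto simp: P_def)
      also have "\<dots> = B u v" using V that by (simp add: P_def if_distrib cong: if_cong)
      finally show ?thesis by simp
    qed
    define e where "e = (1 / sqrt (B w w)) *\<^sub>R w"
    have ee: "B e e = 1" using w by (simp add: e_def bilinear_lmul[OF bil] bilinear_rmul[OF bil] field_simps)
    have ev: "B e v = 0" "B v e = 0" if "v \<in> V" for v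
      using orth[OF that] sym[of v] by (simp_all add: e_def bilinear_lmul[OF bil] bilinear_rmul[OF bil])
    have "e \<notin> V" using ee ev by fastforce
    moreover have "P (insert e V)" using V ee ev by (auto simp: P_def)
    ultimately show False using max[of "insert e V"] V by (simp add: P_def)
  qed
  moreover have "finite V" "\<And>v w. v \<in> V \<Longrightarrow> w \<in> V \<Longrightarrow> B v w = (if v = w then 1 else 0)"
    using V by (simp_all add: P_def)
  ultimately show thesis using card[OF V] that[of V] by simp
qed

lemma
  fixes s :: "'x \<Rightarrow> real"
  assumes N: "prob_space N" and I: "finite I" and s: "integrable N s" "integrable N (\<lambda>x. (s x)\<^sup>2)"
    and mean: "(\<integral>x. s x \<partial>N) = 0"
  shows integrable_sum_square_PiM: "integrable (PiM I (\<lambda>_. N)) (\<lambda>y. (\<Sum>i\<in>I. s (y i))\<^sup>2)"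
    and integral_sum_square_PiM:
      "(\<integral>y. (\<Sum>i\<in>I. s (y i))\<^sup>2 \<partial>PiM I (\<lambda>_. N)) = card I * (\<integral>x. (s x)\<^sup>2 \<partial>N)"
proof -
  interpret N: prob_space N by fact
  have meas: "(\<lambda>y. (\<Sum>i\<in>I. s (y i))\<^sup>2) \<in> borel_measurable (PiM I (\<lambda>_. N))" for I :: "'i set"
    using s(1) by measurable
  have "integrable (PiM I (\<lambda>_. N)) (\<lambda>y. (\<Sum>i\<in>I. s (y i))\<^sup>2) \<and>
    (\<integral>y. (\<Sum>i\<in>I. s (y i))\<^sup>2 \<partial>PiM I (\<lambda>_. N)) = card I * (\<integral>x. (s x)\<^sup>2 \<partial>N)"
    using I
  proof (induction I rule: finite_induct)
    case empty
    interpret N0: prob_space "PiM {} (\<lambda>_. N)" by (intro prob_space_PiM N)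
    show ?case by simp
  next
    case (insert i I)
    interpret NI: prob_space "PiM I (\<lambda>_. N)" by (intro prob_space_PiM N)
    have upd: "(\<Sum>j\<in>insert i I. s ((y(i := x)) j)) = s x + (\<Sum>j\<in>I. s (y j))" for x y
      using insert.hyps by (simp add: sum.insert) (intro sum.cong, auto)
    have i2: "integrable (N \<Otimes>\<^sub>M PiM I (\<lambda>_. N)) (\<lambda>z. 2 * (s (fst z))\<^sup>2 + 2 * (\<Sum>j\<in>I. s (snd z j))\<^sup>2)"
      using insert.IH s by (intro integrable_pair_add[OF N NI.prob_space_axioms]) auto
    have "integrable (N \<Otimes>\<^sub>M PiM I (\<lambda>_. N)) (\<lambda>z. (s (fst z) + (\<Sum>j\<in>I. s (snd z j)))\<^sup>2)"
    proof (rule Bochner_Integration.integrable_bound[OF i2])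
      show "(\<lambda>z. (s (fst z) + (\<Sum>j\<in>I. s (snd z j)))\<^sup>2) \<in> borel_measurable (N \<Otimes>\<^sub>M PiM I (\<lambda>_. N))"
        using s(1) by measurable
      have "(a + b)\<^sup>2 \<le> 2 * a\<^sup>2 + 2 * b\<^sup>2" for a b :: real
        using zero_le_power2[of "a - b"] by (simp add: power2_sum power2_diff)
      then show "AE z in N \<Otimes>\<^sub>M PiM I (\<lambda>_. N). norm ((s (fst z) + (\<Sum>j\<in>I. s (snd z j)))\<^sup>2)
          \<le> norm (2 * (s (fst z))\<^sup>2 + 2 * (\<Sum>j\<in>I. s (snd z j))\<^sup>2)"
        by simp
    qed
    then have int: "integrable (PiM (insert i I) (\<lambda>_. N)) (\<lambda>y. (\<Sum>j\<in>insert i I. s (y j))\<^sup>2)"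
      unfolding integrable_PiM_insert_pair[OF N meas] upd .
    have "(\<integral>y. (\<Sum>j\<in>insert i I. s (y j))\<^sup>2 \<partial>PiM (insert i I) (\<lambda>_. N))
        = (\<integral>y. (\<integral>x. (s x + (\<Sum>j\<in>I. s (y j)))\<^sup>2 \<partial>N) \<partial>PiM I (\<lambda>_. N))"
      using integral_PiM_insert_Fubini(3)[OF N int] by (simp only: upd)
    also have "\<dots> = (\<integral>y. (\<integral>x. (s x)\<^sup>2 \<partial>N) + (\<Sum>j\<in>I. s (y j))\<^sup>2 \<partial>PiM I (\<lambda>_. N))"
      using s mean by (intro Bochner_Integration.integral_cong) (simp_all add: power2_sum N.prob_space)
    also have "\<dots> = card (insert i I) * (\<integral>x. (s x)\<^sup>2 \<partial>N)"
      using insert.IH insert.hyps by (simp add: NI.prob_space algebra_simps)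
    finally show ?case using int by simp
  qed
  then show "integrable (PiM I (\<lambda>_. N)) (\<lambda>y. (\<Sum>i\<in>I. s (y i))\<^sup>2)"
    and "(\<integral>y. (\<Sum>i\<in>I. s (y i))\<^sup>2 \<partial>PiM I (\<lambda>_. N)) = card I * (\<integral>x. (s x)\<^sup>2 \<partial>N)" by auto
qed

lemma (in prob_space) integrable_of_integrable_square:
  fixes Z :: "'a \<Rightarrow> real"
  assumes "Z \<in> borel_measurable M" "integrable M (\<lambda>x. (Z x)\<^sup>2)"
  shows "integrable M Z"
proof (rule Bochner_Integration.integrable_bound)
  show "integrable M (\<lambda>x. 1 + (Z x)\<^sup>2)" using assms by simp
  have "\<bar>z\<bar> \<le> 1 + z\<^sup>2" for z :: real
    using zero_le_power2[of "\<bar>z\<bar> - 1 / 2"] by (simp add: power2_diff) (simp add: power2_eq_square)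
  then show "AE x in M. norm (Z x) \<le> norm (1 + (Z x)\<^sup>2)" by (simp add: abs_of_nonneg)
qed (use assms in auto)

text \<open>In a basis that is orthonormal for the (possibly degenerate) form \<open>E (x \<bullet> u) (x \<bullet> v)\<close>,
  the maximum is at most the Euclidean norm of the coordinates of the random sum.\<close>

lemma expectation_Max_inner_sum_le:
  fixes Q :: "'x::euclidean_space measure" and F :: "'x set"
  assumes Q: "prob_space Q" "sets Q = sets borel" and F: "finite F" "F \<noteq> {}" and I: "finite I" "I \<noteq> {}"
    and sq: "\<And>u. integrable Q (\<lambda>x. (x \<bullet> u)\<^sup>2)"
    and one: "\<And>u. u \<in> F \<Longrightarrow> (\<integral>x. (x \<bullet> u)\<^sup>2 \<partial>Q) \<le> 1"
  shows "(\<integral>y. Max ((\<lambda>u. \<Sum>i\<in>I. y i \<bullet> u) ` F) \<partial>PiM I (\<lambda>_. symmetrize Q)) \<le> sqrt (card I * DIM('x))"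
proof -
  interpret Q: prob_space Q by fact
  define N where "N = symmetrize Q"
  interpret N: prob_space N unfolding N_def by (rule prob_space_symmetrize[OF Q])
  define NI where "NI = PiM I (\<lambda>_. N)"
  interpret NI: prob_space NI unfolding NI_def by (intro prob_space_PiM N.prob_space_axioms)
  have [measurable_cong]: "sets Q = sets borel" by fact
  have meas: "(\<lambda>x. x \<bullet> u) \<in> borel_measurable Q" for u by measurable
  have int1: "integrable Q (\<lambda>x. x \<bullet> u)" for u
    by (rule Q.integrable_of_integrable_square[OF meas sq])
  define B where "B = (\<lambda>u v. \<integral>x. (x \<bullet> u) * (x \<bullet> v) \<partial>Q)"
  have intB: "integrable Q (\<lambda>x. (x \<bullet> u) * (x \<bullet> v))" for u v
  proof -
    have eq: "(\<lambda>x. (x \<bullet> u) * (x \<bullet> v)) = (\<lambda>x. ((x \<bullet> (u + v))\<^sup>2 - (x \<bullet> (u - v))\<^sup>2) / 4)"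
      by (auto simp: inner_add_right inner_diff_right power2_sum power2_diff)
    show ?thesis unfolding eq using sq by simp
  qed
  have Bself: "B u u = (\<integral>x. (x \<bullet> u)\<^sup>2 \<partial>Q)" for u by (simp add: B_def power2_eq_square)
  have bil: "bilinear B"
    unfolding bilinear_def
    by (intro conjI allI linearI) (use intB in \<open>auto simp: B_def inner_add_right algebra_simps\<close>)
  obtain V where V: "finite V" "card V \<le> DIM('x)"
    "\<And>v w. v \<in> V \<Longrightarrow> w \<in> V \<Longrightarrow> B v w = (if v = w then 1 else 0)"
    "\<And>u. B (u - (\<Sum>v\<in>V. B u v *\<^sub>R v)) (u - (\<Sum>v\<in>V. B u v *\<^sub>R v)) = 0"
    by (rule exists_orthonormal_family[OF bil]) (auto simp: B_def mult.commute)
  \<comment> \<open>Parseval's identity instead of Bessel's inequality, because the residual of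
    \<open>u\<close> is null for \<open>B\<close>.\<close>
  have bessel: "(\<Sum>v\<in>V. (B u v)\<^sup>2) = B u u" for u
  proof -
    let ?p = "\<Sum>v\<in>V. B u v *\<^sub>R v"
    have sumr: "B w ?p = (\<Sum>v\<in>V. B u v * B w v)" for w
      using bil by (simp add: bilinear_def linear_sum linear_scale)
    have "B ?p ?p = (\<Sum>v\<in>V. B u v * B ?p v)" by (rule sumr)
    also have "\<dots> = (\<Sum>v\<in>V. (B u v)\<^sup>2)"
    proof (rule sum.cong)
      fix v assume v: "v \<in> V"
      have "B ?p v = (\<Sum>w\<in>V. B u w * B w v)"
        using bil linear_sum[of "\<lambda>w. B w v" "\<lambda>v. B u v *\<^sub>R v" V] by (simp add: bilinear_def bilinear_lmul[OF bil])
      also have "\<dots> = (\<Sum>w\<in>V. B u w * (if w = v then 1 else 0))"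
        using V(3) v by (intro sum.cong) auto
      also have "\<dots> = B u v" using V(1) v by (simp add: if_distrib cong: if_cong)
      finally show "B u v * B ?p v = (B u v)\<^sup>2" by (simp add: power2_eq_square)
    qed simp
    finally have pp: "B ?p ?p = (\<Sum>v\<in>V. (B u v)\<^sup>2)" .
    have up: "B u ?p = (\<Sum>v\<in>V. (B u v)\<^sup>2)" by (simp add: sumr power2_eq_square)
    have pu: "B ?p u = B u ?p" by (simp add: B_def mult.commute)
    have "0 = B (u - ?p) (u - ?p)" using V(4)[of u] by simp
    also have "\<dots> = B u u - B u ?p - B ?p u + B ?p ?p"
      by (simp add: bilinear_lsub[OF bil] bilinear_rsub[OF bil])
    finally show ?thesis using pp up pu by simp
  qed
  define S where "S = (\<lambda>y u. \<Sum>i\<in>I. (y i :: 'x) \<bullet> u)"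
  have N1: "integrable N (\<lambda>x. x \<bullet> u)" and N2: "integrable N (\<lambda>x. (x \<bullet> u)\<^sup>2)" for u
    unfolding N_def using int1 sq by (intro integrable_symmetrize[OF Q]; simp)+
  have N10: "(\<integral>x. x \<bullet> u \<partial>N) = 0" and N20: "(\<integral>x. (x \<bullet> u)\<^sup>2 \<partial>N) = B u u" for u
    unfolding N_def Bself using int1 sq by (subst integral_symmetrize[OF Q]; simp)+
  have S2: "integrable NI (\<lambda>y. (S y u)\<^sup>2)" and S20: "(\<integral>y. (S y u)\<^sup>2 \<partial>NI) = card I * B u u" for u
    unfolding S_def NI_def
    using integrable_sum_square_PiM[OF N.prob_space_axioms I(1) N1 N2 N10, of u]
      integral_sum_square_PiM[OF N.prob_space_axioms I(1) N1 N2 N10, of u] by (simp_all add: N20)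
  have S1: "integrable NI (\<lambda>y. S y u)" for u
    unfolding S_def NI_def
    by (intro Bochner_Integration.integrable_sum integrable_PiM_component[OF N.prob_space_axioms _ N1])
  \<comment> \<open>The weight in Young's inequality, which linearizes Cauchy-Schwarz and so avoids
    the mean of a square root. The resulting mean \<open>c / 2 + card I * card V / (2 * c)\<close>
    is at most \<open>c\<close> for this choice.\<close>
  define c where "c = sqrt (card I * DIM('x))"
  have cpos: "0 < c" unfolding c_def using I by (simp add: card_gt_0_iff)
  have "AE y in NI. S y u \<le> c / 2 + (\<Sum>v\<in>V. (S y v)\<^sup>2) / (2 * c)" if "u \<in> F" for u
  proof -
    let ?p = "\<Sum>v\<in>V. B u v *\<^sub>R v"
    \<comment> \<open>The residual sum has second moment zero and so vanishes almost surely. The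
      exceptional set depends on \<open>u\<close>; finiteness of \<open>F\<close> keeps the union
      null.\<close>
    have "AE y in NI. (S y (u - ?p))\<^sup>2 = 0"
      using S20[of "u - ?p"] V(4)[of u] by (subst integral_nonneg_eq_0_iff_AE[symmetric]) (auto intro: S2)
    then show ?thesis
    proof eventually_elim
      case (elim y)
      have "S y u = S y ?p"
        using elim by (simp add: S_def inner_diff_right sum_subtractf)
      also have "\<dots> = (\<Sum>v\<in>V. B u v * S y v)"
        by (simp add: S_def inner_sum_right sum_distrib_left) (rule sum.swap)
      also have "\<dots> \<le> (\<Sum>v\<in>V. c / 2 * (B u v)\<^sup>2 + (S y v)\<^sup>2 / (2 * c))"
      proof (rule sum_mono)
        fix v
        have "c * (B u v * S y v) * 2 \<le> (c * B u v)\<^sup>2 + (S y v)\<^sup>2"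
          using zero_le_power2[of "c * B u v - S y v"] by (simp add: power2_diff algebra_simps)
        then show "B u v * S y v \<le> c / 2 * (B u v)\<^sup>2 + (S y v)\<^sup>2 / (2 * c)"
          using cpos by (simp add: field_simps power2_eq_square)
      qed
      also have "\<dots> = c / 2 * B u u + (\<Sum>v\<in>V. (S y v)\<^sup>2) / (2 * c)"
        by (simp add: sum.distrib bessel[symmetric] sum_distrib_left sum_divide_distrib)
      also have "\<dots> \<le> c / 2 + (\<Sum>v\<in>V. (S y v)\<^sup>2) / (2 * c)"
        using one[OF that] cpos by (simp add: Bself)
      finally show ?case .
    qed
  qed
  then have "AE y in NI. \<forall>u\<in>F. S y u \<le> c / 2 + (\<Sum>v\<in>V. (S y v)\<^sup>2) / (2 * c)"
    using F(1) by (simp add: AE_finite_all)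
  then have ae: "AE y in NI. Max (S y ` F) \<le> c / 2 + (\<Sum>v\<in>V. (S y v)\<^sup>2) / (2 * c)"
    by eventually_elim (use F in auto)
  have "(\<integral>y. Max (S y ` F) \<partial>NI) \<le> (\<integral>y. c / 2 + (\<Sum>v\<in>V. (S y v)\<^sup>2) / (2 * c) \<partial>NI)"
    using S1 S2 by (intro integral_mono_AE integrable_Max_image F ae) auto
  also have "\<dots> = c / 2 + (\<Sum>v\<in>V. card I * B v v) / (2 * c)"
    using S2 S20 by (simp add: NI.prob_space)
  also have "(\<Sum>v\<in>V. card I * B v v) = card I * card V" using V(3) by simp
  also have "c / 2 + card I * card V / (2 * c) \<le> c / 2 + (c * c) / (2 * c)"
    unfolding c_def using V(2) by (intro add_left_mono divide_right_mono) (auto intro!: mult_left_mono)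
  also have "\<dots> = c" using cpos by simp
  finally show ?thesis by (simp add: c_def S_def NI_def N_def)
qed

section \<open>Bernstein moments and truncation\<close>

text \<open>Layer cake: the excess over the truncation level is the integral of \<open>2 * s\<close>
  over \<open>s\<close> from \<open>K\<close> up to \<open>\<bar>Y x\<bar>\<close>, so its mean
  integrates \<open>2 * s\<close> against the tail. The tail bound leaves
  \<open>2 * C powr m * s powr (1 - m)\<close>, which is integrable at infinity because
  \<open>m > 2\<close>.\<close>

lemma truncation_bias:
  fixes Y :: "'a \<Rightarrow> real"
  assumes Q: "prob_space Q" and Y: "Y \<in> borel_measurable Q" "integrable Q (\<lambda>x. (Y x)\<^sup>2)"
    and tail: "\<And>t. t > 0 \<Longrightarrow> measure Q {x \<in> space Q. \<bar>Y x\<bar> > t} \<le> (C / t) powr m"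
    and m: "m > 2" and C: "C > 0" and K: "K > 0"
  shows "(\<integral>x. (Y x)\<^sup>2 - min ((Y x)\<^sup>2) (K\<^sup>2) \<partial>Q) \<le> 2 * C powr m * K powr (2 - m) / (m - 2)"
proof -
  interpret Q: prob_space Q by fact
  interpret QL: pair_sigma_finite Q lborel ..
  note [measurable] = Y(1)
  have cake: "ennreal ((Y x)\<^sup>2 - min ((Y x)\<^sup>2) (K\<^sup>2))
      = (\<integral>\<^sup>+s. ennreal (2 * s) * indicator {K..} s * indicator {s. s < \<bar>Y x\<bar>} s \<partial>lborel)" for x
  proof -
    have "(\<integral>\<^sup>+s. ennreal (2 * s) * indicator {K..} s * indicator {s. s < \<bar>Y x\<bar>} s \<partial>lborel)
        = (\<integral>\<^sup>+s. ennreal (2 * s) * indicator {K..\<bar>Y x\<bar>} s \<partial>lborel)"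
      \<comment> \<open>The strict inequality matches the tail event of weak isotropy; it differs
        from the closed interval only at the point \<open>\<bar>Y x\<bar>\<close>.\<close>
      using AE_lborel_singleton[of "\<bar>Y x\<bar>"]
      by (intro nn_integral_cong_AE, eventually_elim) (auto split: split_indicator)
    also have "\<dots> = ennreal ((Y x)\<^sup>2 - min ((Y x)\<^sup>2) (K\<^sup>2))"
    proof (cases "K \<le> \<bar>Y x\<bar>")
      case True
      have "(\<integral>\<^sup>+s. ennreal (2 * s) * indicator {K..\<bar>Y x\<bar>} s \<partial>lborel) = \<bar>Y x\<bar>\<^sup>2 - K\<^sup>2"
        using True K by (intro nn_integral_FTC_Icc) (auto intro!: derivative_eq_intros)
      moreover have "K\<^sup>2 \<le> (Y x)\<^sup>2" using True K by (metis abs_le_square_iff abs_of_pos)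
      ultimately show ?thesis by simp
    next
      case False
      then have "(Y x)\<^sup>2 \<le> K\<^sup>2" using K by (metis abs_le_square_iff abs_of_pos linear)
      with False show ?thesis by simp
    qed
    finally show ?thesis by simp
  qed
  have meas: "(\<lambda>(x, s). ennreal (2 * s) * indicator {K..} s * indicator {s. s < \<bar>Y x\<bar>} s)
      \<in> borel_measurable (Q \<Otimes>\<^sub>M lborel)"
    unfolding indicator_def mem_Collect_eq case_prod_beta' by measurable
  have "(\<integral>\<^sup>+x. ennreal ((Y x)\<^sup>2 - min ((Y x)\<^sup>2) (K\<^sup>2)) \<partial>Q)
      = (\<integral>\<^sup>+s. (\<integral>\<^sup>+x. ennreal (2 * s) * indicator {K..} s * indicator {s. s < \<bar>Y x\<bar>} s \<partial>Q) \<partial>lborel)"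
    unfolding cake using QL.Fubini'[OF meas] by simp
  also have "\<dots> \<le> (\<integral>\<^sup>+s. ennreal (2 * C powr m * s powr (1 - m)) * indicator {K..} s \<partial>lborel)"
  proof (intro nn_integral_mono)
    fix s :: real
    show "(\<integral>\<^sup>+x. ennreal (2 * s) * indicator {K..} s * indicator {s. s < \<bar>Y x\<bar>} s \<partial>Q)
        \<le> ennreal (2 * C powr m * s powr (1 - m)) * indicator {K..} s"
    proof (cases "K \<le> s")
      case True
      then have s: "s > 0" using K by simp
      have "(\<integral>\<^sup>+x. ennreal (2 * s) * indicator {K..} s * indicator {s. s < \<bar>Y x\<bar>} s \<partial>Q)
          = (\<integral>\<^sup>+x. ennreal (2 * s) * indicator {x \<in> space Q. \<bar>Y x\<bar> > s} x \<partial>Q)"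
        using True by (intro nn_integral_cong) (auto split: split_indicator)
      also have "\<dots> = ennreal (2 * s) * emeasure Q {x \<in> space Q. \<bar>Y x\<bar> > s}"
        by (rule nn_integral_cmult_indicator) measurable
      also have "\<dots> = ennreal (2 * s * measure Q {x \<in> space Q. \<bar>Y x\<bar> > s})"
        using s by (simp add: Q.emeasure_eq_measure ennreal_mult)
      also have "\<dots> \<le> ennreal (2 * s * (C / s) powr m)"
        using tail[OF s] s by (intro ennreal_leI mult_left_mono) auto
      also have "2 * s * (C / s) powr m = 2 * C powr m * s powr (1 - m)"
        using s C by (simp add: powr_divide powr_diff)
      finally show ?thesis using True by simp
    qed simp
  qed
  also have "\<dots> = ennreal (0 - 2 * C powr m / (2 - m) * K powr (2 - m))"
  proof (rule nn_integral_FTC_atLeast)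
    fix x assume x: "K \<le> x"
    have "((\<lambda>x. 2 * C powr m / (2 - m) * x powr (2 - m)) has_real_derivative
        2 * C powr m / (2 - m) * ((2 - m) * x powr (2 - m - 1))) (at x)"
      using x K by (intro DERIV_cmult has_real_derivative_powr) auto
    moreover have "2 * C powr m / (2 - m) * ((2 - m) * x powr (2 - m - 1)) = 2 * C powr m * x powr (1 - m)"
      using m by simp
    ultimately show "((\<lambda>x. 2 * C powr m / (2 - m) * x powr (2 - m)) has_real_derivative
        2 * C powr m * x powr (1 - m)) (at x)" by simp
    show "0 \<le> 2 * C powr m * x powr (1 - m)" by simp
  next
    have "((\<lambda>x. x powr (2 - m)) \<longlongrightarrow> 0) at_top"
      using m by (intro tendsto_neg_powr filterlim_ident) auto
    then show "((\<lambda>x. 2 * C powr m / (2 - m) * x powr (2 - m)) \<longlongrightarrow> 0) at_top"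
      by (rule tendsto_mult_right_zero)
  qed measurable
  also have "0 - 2 * C powr m / (2 - m) * K powr (2 - m) = 2 * C powr m * K powr (2 - m) / (m - 2)"
    using m by (simp add: field_simps)
  finally have le: "(\<integral>\<^sup>+x. ennreal ((Y x)\<^sup>2 - min ((Y x)\<^sup>2) (K\<^sup>2)) \<partial>Q)
      \<le> ennreal (2 * C powr m * K powr (2 - m) / (m - 2))" .
  show ?thesis
  proof (rule integral_real_bounded[OF _ le])
    show "0 \<le> 2 * C powr m * K powr (2 - m) / (m - 2)" using m by simp
  qed
qed

section \<open>Exponential moments and the largest coordinate under the Bernstein condition\<close>

lemma (in prob_space) integrable_of_bernstein:
  fixes Z :: "'a \<Rightarrow> real"
  assumes "Z \<in> borel_measurable M" "bernstein M Z \<sigma> K"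
  shows "integrable M Z"
proof (rule integrable_of_integrable_square[OF assms(1)])
  show "integrable M (\<lambda>x. (Z x)\<^sup>2)"
    using assms(2)[unfolded bernstein_def, rule_format, of 2] by simp
qed

text \<open>The Bernstein condition bounds moments from order 2 on and says nothing about centering,
  so the linear term of the exponential series stays on the left. The other terms are dominated by a
  geometric series of ratio \<open>l * K\<close>.\<close>

lemma (in prob_space) bernstein_exp_moment:
  fixes Z :: "'a \<Rightarrow> real"
  assumes Z: "Z \<in> borel_measurable M" "bernstein M Z \<sigma> K" and K: "0 \<le> K" and l: "0 \<le> l" "l * K < 1"
  shows "integrable M (\<lambda>x. exp (l * \<bar>Z x\<bar>))"
    and "integrable M (\<lambda>x. \<bar>Z x\<bar>)"
    and "expectation (\<lambda>x. exp (l * \<bar>Z x\<bar>)) - l * expectation (\<lambda>x. \<bar>Z x\<bar>) \<le> 1 + l\<^sup>2 * \<sigma>\<^sup>2 / (2 * (1 - l * K))"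
proof -
  have mom: "integrable M (\<lambda>x. \<bar>Z x\<bar> ^ k)" "expectation (\<lambda>x. \<bar>Z x\<bar> ^ k) \<le> fact k / 2 * K ^ (k - 2) * \<sigma>\<^sup>2"
    if "k \<ge> 2" for k :: nat using Z(2) that by (auto simp: bernstein_def)
  have "integrable M (\<lambda>x. (Z x)\<^sup>2)" using mom(1)[of 2] by simp
  from integrable_of_integrable_square[OF Z(1) this] show abs: "integrable M (\<lambda>x. \<bar>Z x\<bar>)" by simp
  \<comment> \<open>\<open>a k\<close> is the term of order \<open>k + 2\<close>, so that
    \<open>k = 0\<close> is the first order under control.\<close>
  define a where "a = (\<lambda>k x. (l * \<bar>Z x\<bar>) ^ (k + 2) / fact (k + 2))"
  have a_int: "integrable M (a k)" for k
    unfolding a_def power_mult_distrib using mom(1)[of "k + 2"] by simp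
  have a_nn: "0 \<le> a k x" for k x using l by (simp add: a_def)
  have a_exp: "expectation (a k) \<le> l\<^sup>2 * \<sigma>\<^sup>2 / 2 * (l * K) ^ k" for k
  proof -
    have "expectation (a k) = l ^ (k + 2) / fact (k + 2) * expectation (\<lambda>x. \<bar>Z x\<bar> ^ (k + 2))"
      by (simp only: a_def power_mult_distrib times_divide_eq_left flip: integral_mult_right_zero)
    also have "\<dots> \<le> l ^ (k + 2) / fact (k + 2) * (fact (k + 2) / 2 * K ^ (k + 2 - 2) * \<sigma>\<^sup>2)"
      using mom(2)[of "k + 2"] l by (intro mult_left_mono) auto
    also have "\<dots> = l\<^sup>2 * \<sigma>\<^sup>2 / 2 * (l * K) ^ k"
      by (simp add: power_mult_distrib power_add power2_eq_square field_simps del: fact_Suc)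
    finally show ?thesis .
  qed
  have geo: "(\<lambda>k. l\<^sup>2 * \<sigma>\<^sup>2 / 2 * (l * K) ^ k) sums (l\<^sup>2 * \<sigma>\<^sup>2 / 2 * (1 / (1 - l * K)))"
    using l K by (intro sums_mult geometric_sums) simp
  have nrm: "expectation (\<lambda>x. norm (a k x)) = expectation (a k)" for k using a_nn by simp
  have sumE: "summable (\<lambda>k. expectation (\<lambda>x. norm (a k x)))"
    unfolding nrm
    by (rule summable_comparison_test[OF _ sums_summable[OF geo]]) (use a_exp a_nn in \<open>auto simp: integral_nonneg_AE\<close>)
  have a_sums: "(\<lambda>k. a k x) sums (exp (l * \<bar>Z x\<bar>) - 1 - l * \<bar>Z x\<bar>)" for x
  proof -
    have "(\<lambda>k. (l * \<bar>Z x\<bar>) ^ k / fact k) sums exp (l * \<bar>Z x\<bar>)"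
      using exp_converges[of "l * \<bar>Z x\<bar>"] by (simp add: divide_inverse mult.commute)
    from sums_split_initial_segment[OF this, of 2] show ?thesis
      unfolding a_def by (simp add: lessThan_nat_numeral algebra_simps eval_nat_numeral)
  qed
  have a_abs: "summable (\<lambda>k. norm (a k x))" for x
    using sums_summable[OF a_sums[of x]] a_nn by simp
  have int: "integrable M (\<lambda>x. \<Sum>k. a k x)"
    by (rule integrable_suminf[OF a_int AE_I2[OF a_abs] sumE])
  have suminf: "(\<Sum>k. a k x) = exp (l * \<bar>Z x\<bar>) - 1 - l * \<bar>Z x\<bar>" for x
    using sums_unique[OF a_sums] by simp
  have int': "integrable M (\<lambda>x. exp (l * \<bar>Z x\<bar>) - 1 - l * \<bar>Z x\<bar>)" using int unfolding suminf .
  have "integrable M (\<lambda>x. (exp (l * \<bar>Z x\<bar>) - 1 - l * \<bar>Z x\<bar>) + (1 + l * \<bar>Z x\<bar>))"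
    using int' abs by (intro Bochner_Integration.integrable_add) auto
  then show expi: "integrable M (\<lambda>x. exp (l * \<bar>Z x\<bar>))" by simp
  have "expectation (\<lambda>x. exp (l * \<bar>Z x\<bar>)) - 1 - l * expectation (\<lambda>x. \<bar>Z x\<bar>)
      = expectation (\<lambda>x. \<Sum>k. a k x)"
    unfolding suminf using expi abs by (simp add: prob_space)
  also have "\<dots> = (\<Sum>k. expectation (a k))"
    by (rule integral_suminf[OF a_int AE_I2[OF a_abs] sumE])
  also have "\<dots> \<le> (\<Sum>k. l\<^sup>2 * \<sigma>\<^sup>2 / 2 * (l * K) ^ k)"
    using sumE unfolding nrm by (intro suminf_le a_exp sums_summable[OF geo])
  also have "\<dots> = l\<^sup>2 * \<sigma>\<^sup>2 / (2 * (1 - l * K))"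
    using sums_unique[OF geo] by simp
  finally show "expectation (\<lambda>x. exp (l * \<bar>Z x\<bar>)) - l * expectation (\<lambda>x. \<bar>Z x\<bar>)
      \<le> 1 + l\<^sup>2 * \<sigma>\<^sup>2 / (2 * (1 - l * K))" by simp
qed

text \<open>Symmetrization turns the exponential moment of a row into the mean of a hyperbolic
  cosine, and \<open>cosh s \<le> exp s - s\<close> for \<open>s \<ge> 0\<close> is just
  \<open>s \<le> sinh s\<close>. The subtracted linear term is the one that
  \<open>bernstein_exp_moment\<close> keeps on its left. The sign \<epsilon> is fixed and selects
  one side of an absolute value; the random sign sits in \<open>symmetrize Q\<close>.\<close>

lemma exp_sum_moment_symmetrize:
  fixes Q :: "'x::euclidean_space measure" and I :: "'i set"
  assumes Q: "prob_space Q" "sets Q = sets borel" and I: "finite I"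
    and b: "bernstein Q (\<lambda>x. x \<bullet> w) \<sigma> K" and K: "0 \<le> K" and l: "0 \<le> l" "l * K < 1"
    and \<epsilon>: "\<epsilon> \<in> {1, - 1 :: real}"
  shows "integrable (PiM I (\<lambda>_. symmetrize Q)) (\<lambda>y. exp (l * (\<epsilon> * (\<Sum>i\<in>I. y i \<bullet> w))))"
    and "(\<integral>y. exp (l * (\<epsilon> * (\<Sum>i\<in>I. y i \<bullet> w))) \<partial>PiM I (\<lambda>_. symmetrize Q))
      \<le> exp (card I * (l\<^sup>2 * \<sigma>\<^sup>2 / (2 * (1 - l * K))))"
proof -
  interpret Q: prob_space Q by fact
  define N where "N = symmetrize Q"
  interpret N: prob_space N unfolding N_def by (rule prob_space_symmetrize[OF Q])
  interpret PN: product_prob_space "\<lambda>_. N" I ..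
  have [measurable_cong]: "sets Q = sets borel" by fact
  have meas: "(\<lambda>x. x \<bullet> w) \<in> borel_measurable Q" by measurable
  note be = Q.bernstein_exp_moment[OF meas b K l]
  have dom: "integrable Q (\<lambda>x. exp (l * (c * (x \<bullet> w))))" if "c \<in> {1, -1}" for c
  proof (rule Bochner_Integration.integrable_bound[OF be(1)])
    show "AE x in Q. norm (exp (l * (c * (x \<bullet> w)))) \<le> norm (exp (l * \<bar>x \<bullet> w\<bar>))"
      using l(1) that by (auto intro!: mult_left_mono)
  qed measurable
  let ?h = "\<lambda>x. exp (l * (\<epsilon> * (x \<bullet> w)))"
  have h: "integrable Q ?h" "integrable Q (\<lambda>x. ?h (- x))"
    using dom[OF \<epsilon>] dom[of "- \<epsilon>"] \<epsilon> by auto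
  have hN: "integrable N ?h" unfolding N_def by (rule integrable_symmetrize[OF Q h])
  have "?h x + ?h (- x) \<le> 2 * (exp (l * \<bar>x \<bullet> w\<bar>) - l * \<bar>x \<bullet> w\<bar>)" for x
  proof -
    have sinh: "exp s - s \<ge> exp (- s) + s" if "s \<ge> 0" for s :: real
    proof -
      have "s \<le> (exp s - inverse (exp s)) / 2" by (rule real_le_x_sinh[OF that])
      then show ?thesis by (simp add: exp_minus)
    qed
    have "?h x + ?h (- x) = exp (l * \<bar>x \<bullet> w\<bar>) + exp (- (l * \<bar>x \<bullet> w\<bar>))"
      using \<epsilon> by (auto simp: abs_if)
    then show ?thesis using sinh[of "l * \<bar>x \<bullet> w\<bar>"] l by simp
  qed
  then have "(\<integral>x. ?h x + ?h (- x) \<partial>Q) \<le> (\<integral>x. 2 * (exp (l * \<bar>x \<bullet> w\<bar>) - l * \<bar>x \<bullet> w\<bar>) \<partial>Q)"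
    using h be(1,2) by (intro integral_mono) auto
  then have "(\<integral>x. ?h x \<partial>N) \<le> (\<integral>x. exp (l * \<bar>x \<bullet> w\<bar>) \<partial>Q) - l * (\<integral>x. \<bar>x \<bullet> w\<bar> \<partial>Q)"
    unfolding N_def integral_symmetrize[OF Q h] using h be(1,2) by simp
  also have "\<dots> \<le> 1 + l\<^sup>2 * \<sigma>\<^sup>2 / (2 * (1 - l * K))" by (rule be(3))
  also have "\<dots> \<le> exp (l\<^sup>2 * \<sigma>\<^sup>2 / (2 * (1 - l * K)))" by (rule exp_ge_add_one_self)
  finally have mgf: "(\<integral>x. ?h x \<partial>N) \<le> exp (l\<^sup>2 * \<sigma>\<^sup>2 / (2 * (1 - l * K)))" .
  have prod: "exp (l * (\<epsilon> * (\<Sum>i\<in>I. y i \<bullet> w))) = (\<Prod>i\<in>I. ?h (y i))" for y :: "'i \<Rightarrow> 'x"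
    by (simp add: sum_distrib_left flip: exp_sum[OF I])
  show "integrable (PiM I (\<lambda>_. symmetrize Q)) (\<lambda>y. exp (l * (\<epsilon> * (\<Sum>i\<in>I. y i \<bullet> w))))"
    unfolding prod N_def[symmetric] by (rule PN.product_integrable_prod[OF I hN])
  have "(\<integral>y. exp (l * (\<epsilon> * (\<Sum>i\<in>I. y i \<bullet> w))) \<partial>PiM I (\<lambda>_. N)) = (\<integral>x. ?h x \<partial>N) ^ card I"
    unfolding prod by (subst PN.product_integral_prod[OF I hN]) simp
  also have "\<dots> \<le> exp (l\<^sup>2 * \<sigma>\<^sup>2 / (2 * (1 - l * K))) ^ card I"
    by (intro power_mono mgf) simp
  also have "\<dots> = exp (card I * (l\<^sup>2 * \<sigma>\<^sup>2 / (2 * (1 - l * K))))" by (rule exp_of_nat_mult[symmetric])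
  finally show "(\<integral>y. exp (l * (\<epsilon> * (\<Sum>i\<in>I. y i \<bullet> w))) \<partial>PiM I (\<lambda>_. symmetrize Q))
      \<le> exp (card I * (l\<^sup>2 * \<sigma>\<^sup>2 / (2 * (1 - l * K))))" by (simp add: N_def)
qed

lemma (in prob_space) expectation_le_of_exp_moment:
  fixes T :: "'a \<Rightarrow> real"
  assumes "integrable M T" "integrable M (\<lambda>x. exp (l * T x))" "l > 0"
    and le: "expectation (\<lambda>x. exp (l * T x)) \<le> c"
  shows "expectation T \<le> ln c / l"
proof -
  have "exp (expectation (\<lambda>x. l * T x)) \<le> expectation (\<lambda>x. exp (l * T x))"
    by (rule jensens_inequality[where I = UNIV]) (use assms exp_convex in auto)
  with le have e: "exp (l * expectation T) \<le> c" by simp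
  then have "c > 0" using exp_gt_zero less_le_trans by blast
  with e have "l * expectation T \<le> ln c" by (simp add: ln_ge_iff)
  with assms show ?thesis by (simp add: field_simps)
qed

text \<open>The exponential of the maximum is at most the sum over the \<open>2 * CARD('p)\<close>
  signed coordinates, whence the logarithm in \<open>delta\<close>. Positive \<sigma> keeps
  \<open>l * K\<close> strictly below 1 at the optimal rate.\<close>

lemma expectation_Max_coordinate_sum_le_pos:
  fixes Q :: "(real ^ 'p) measure"
  assumes Q: "prob_space Q" "sets Q = sets borel" and I: "finite I" "I \<noteq> {}"
    and b: "\<And>j. bernstein Q (\<lambda>x. x $ j) \<sigma> K" and K: "0 \<le> K" and \<sigma>: "0 < \<sigma>"
  shows "(\<integral>y. Max ((\<lambda>j. \<bar>\<Sum>i\<in>I. y i $ j\<bar>) ` UNIV) \<partial>PiM I (\<lambda>_. symmetrize Q))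
    \<le> card I * delta (card I) CARD('p) \<sigma> K"
proof -
  interpret Q: prob_space Q by fact
  define N where "N = symmetrize Q"
  interpret N: prob_space N unfolding N_def by (rule prob_space_symmetrize[OF Q])
  define NI where "NI = PiM I (\<lambda>_. N)"
  interpret NI: prob_space NI unfolding NI_def by (intro prob_space_PiM N.prob_space_axioms)
  have [measurable_cong]: "sets Q = sets borel" by fact
  define L where "L = ln (2 * real CARD('p))"
  define n where "n = real (card I)"
  have n: "n > 0" unfolding n_def using I by (simp add: card_gt_0_iff)
  have "1 < 2 * real CARD('p)"
    using zero_less_card_finite[where 'a = 'p] by (simp del: zero_less_card_finite)
  then have L: "L > 0" by (simp add: L_def)
  define r where "r = sqrt (n / (2 * L))"
  have r: "r > 0" and r2: "n = 2 * L * r\<^sup>2" using n L by (simp_all add: r_def)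
  \<comment> \<open>With \<open>x = 1 / l - K\<close> the bound to be minimized is
    \<open>L * K + L * x + n * \<sigma>\<^sup>2 / (2 * x)\<close>. Its minimizer is
    \<open>x = \<sigma> * r\<close>, and the minimum is exactly \<open>n\<close> times
    \<open>delta\<close>.\<close>
  define l where "l = 1 / (K + \<sigma> * r)"
  have den: "K + \<sigma> * r > 0" using K \<sigma> r by (simp add: add_nonneg_pos)
  have l: "l > 0" using den by (simp add: l_def)
  have lK': "1 - l * K = l * (\<sigma> * r)" using den by (simp add: l_def field_simps)
  have lK: "l * K < 1" using lK' l \<sigma> r by (smt (verit) mult_pos_pos)
  have b': "bernstein Q (\<lambda>x. x \<bullet> axis j 1) \<sigma> K" for j
    using b[of j] by (simp add: inner_axis)
  define T where "T = (\<lambda>y. Max ((\<lambda>j. \<bar>\<Sum>i\<in>I. (y i :: real ^ 'p) $ j\<bar>) ` UNIV))"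
  define A where "A = (\<lambda>e j y. exp (l * (e * (\<Sum>i\<in>I. (y i :: real ^ 'p) $ j))))"
  have A: "integrable NI (A e j)" "(\<integral>y. A e j y \<partial>NI) \<le> exp (n * (l\<^sup>2 * \<sigma>\<^sup>2 / (2 * (1 - l * K))))"
    if "e \<in> {1, -1}" for e j
    using exp_sum_moment_symmetrize[OF Q I(1) b' K less_imp_le[OF l] lK that, of j]
    by (simp_all add: A_def inner_axis NI_def N_def n_def)
  have coord: "integrable NI (\<lambda>y. \<bar>\<Sum>i\<in>I. y i $ j\<bar>)" for j
  proof -
    have "(\<lambda>x. x $ j) \<in> borel_measurable Q" by measurable
    then have "integrable Q (\<lambda>x. x $ j)" by (rule Q.integrable_of_bernstein[OF _ b])
    then have "integrable N (\<lambda>x. x $ j)" unfolding N_def by (intro integrable_symmetrize[OF Q]) auto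
    then show ?thesis unfolding NI_def
      by (intro integrable_abs Bochner_Integration.integrable_sum integrable_PiM_component[OF N.prob_space_axioms])
  qed
  have T_int: "integrable NI T" unfolding T_def by (intro integrable_Max_image coord) auto
  have T_le: "exp (l * T y) \<le> (\<Sum>j\<in>UNIV. A 1 j y + A (-1) j y)" for y
  proof -
    have "T y \<in> (\<lambda>j. \<bar>\<Sum>i\<in>I. y i $ j\<bar>) ` UNIV" unfolding T_def by (rule Max_in) auto
    then obtain j where j: "T y = \<bar>\<Sum>i\<in>I. y i $ j\<bar>" by auto
    have "exp (l * T y) \<le> A 1 j y + A (-1) j y"
      unfolding j A_def by (cases "(\<Sum>i\<in>I. y i $ j) \<ge> 0") auto
    also have "\<dots> \<le> (\<Sum>j\<in>UNIV. A 1 j y + A (-1) j y)"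
      by (rule member_le_sum) (auto simp: A_def)
    finally show ?thesis .
  qed
  have sumA: "integrable NI (\<lambda>y. \<Sum>j\<in>UNIV. A 1 j y + A (-1) j y)" using A(1) by auto
  have expT: "integrable NI (\<lambda>y. exp (l * T y))"
  proof (rule Bochner_Integration.integrable_bound[OF sumA])
    show "(\<lambda>y. exp (l * T y)) \<in> borel_measurable NI" using borel_measurable_integrable[OF T_int] by simp
  qed (use T_le in \<open>auto intro: order_trans[OF _ abs_ge_self]\<close>)
  let ?E = "exp (n * (l\<^sup>2 * \<sigma>\<^sup>2 / (2 * (1 - l * K))))"
  have "(\<integral>y. exp (l * T y) \<partial>NI) \<le> (\<integral>y. (\<Sum>j\<in>UNIV. A 1 j y + A (-1) j y) \<partial>NI)"
    by (rule integral_mono[OF expT sumA T_le])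
  also have "\<dots> = (\<Sum>j\<in>UNIV. (\<integral>y. A 1 j y \<partial>NI) + (\<integral>y. A (-1) j y \<partial>NI))" using A(1) by simp
  also have "\<dots> \<le> (\<Sum>j::'p\<in>UNIV. ?E + ?E)" by (intro sum_mono add_mono A(2)) auto
  also have "\<dots> = 2 * real CARD('p) * ?E" by simp
  finally have "(\<integral>y. T y \<partial>NI) \<le> ln (2 * real CARD('p) * ?E) / l"
    by (rule NI.expectation_le_of_exp_moment[OF T_int expT l])
  also have "ln (2 * real CARD('p) * ?E) = L + n * (l\<^sup>2 * \<sigma>\<^sup>2 / (2 * (1 - l * K)))"
    by (subst ln_mult) (auto simp: L_def)
  also have "(L + n * (l\<^sup>2 * \<sigma>\<^sup>2 / (2 * (1 - l * K)))) / l = L * (1 / l) + L * r * \<sigma>"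
    unfolding lK' using l \<sigma> r by (simp add: r2 field_simps power2_eq_square)
  also have "\<dots> = K * L + \<sigma> * (2 * L * r)" by (simp add: l_def algebra_simps)
  also have "\<dots> = n * delta (card I) CARD('p) \<sigma> K"
  proof -
    have "sqrt (2 * L / n) = 1 / r"
      unfolding r_def using n L by (simp add: real_sqrt_divide)
    moreover have "n * (1 / r) = 2 * L * r" using r by (simp add: r2 power2_eq_square)
    ultimately have "n * sqrt (2 * L / n) = 2 * L * r" by simp
    moreover have "n * delta (card I) CARD('p) \<sigma> K = \<sigma> * (n * sqrt (2 * L / n)) + K * L"
      unfolding delta_def n_def[symmetric] L_def[symmetric] using n by (simp add: algebra_simps)
    ultimately show ?thesis by simp
  qed
  finally show ?thesis by (simp add: T_def NI_def N_def n_def)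
qed

text \<open>At \<open>\<sigma> = 0\<close> there is no admissible optimal rate. As the Bernstein
  condition is monotone in \<sigma> and \<open>delta\<close> is continuous in it, the bound follows
  from \<open>\<sigma> + e\<close> by letting \<open>e\<close> tend to zero.\<close>

lemma expectation_Max_coordinate_sum_le:
  fixes Q :: "(real ^ 'p) measure"
  assumes Q: "prob_space Q" "sets Q = sets borel" and I: "finite I" "I \<noteq> {}"
    and b: "\<And>j. bernstein Q (\<lambda>x. x $ j) \<sigma> K" and K: "0 \<le> K" and \<sigma>: "0 \<le> \<sigma>"
  shows "(\<integral>y. Max ((\<lambda>j. \<bar>\<Sum>i\<in>I. y i $ j\<bar>) ` UNIV) \<partial>PiM I (\<lambda>_. symmetrize Q))
    \<le> card I * delta (card I) CARD('p) \<sigma> K" (is "?T \<le> _")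
proof -
  have "?T \<le> card I * delta (card I) CARD('p) (\<sigma> + e) K" if e: "e > 0" for e
  proof (rule expectation_Max_coordinate_sum_le_pos[OF Q I _ K])
    show "bernstein Q (\<lambda>x. x $ j) (\<sigma> + e) K" for j
    proof -
      have "\<sigma>\<^sup>2 \<le> (\<sigma> + e)\<^sup>2" using \<sigma> e by (intro power_mono) auto
      then have "fact k / 2 * K ^ (k - 2) * \<sigma>\<^sup>2 \<le> fact k / 2 * K ^ (k - 2) * (\<sigma> + e)\<^sup>2" for k :: nat
        using K by (intro mult_left_mono) auto
      with b[of j] show ?thesis unfolding bernstein_def by (meson order_trans)
    qed
  qed (use \<sigma> e in auto)
  then have ev: "eventually (\<lambda>e. ?T \<le> card I * delta (card I) CARD('p) (\<sigma> + e) K) (at_right 0)"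
    by (intro eventually_mono[OF eventually_at_right_less]) simp
  have "((\<lambda>e. card I * delta (card I) CARD('p) (\<sigma> + e) K)
      \<longlongrightarrow> card I * delta (card I) CARD('p) (\<sigma> + 0) K) (at_right 0)"
    unfolding delta_def by (intro tendsto_intros)
  from tendsto_lowerbound[OF this ev] show ?thesis by simp
qed

text \<open>Duality between the l1 norm and the maximum norm reduces all directions to the
  coordinates.\<close>

lemma expectation_Max_inner_sum_le_l1:
  fixes Q :: "(real ^ 'p) measure" and F :: "(real ^ 'p) set"
  assumes Q: "prob_space Q" "sets Q = sets borel" and I: "finite I" "I \<noteq> {}"
    and F: "finite F" "F \<noteq> {}" "\<And>u. u \<in> F \<Longrightarrow> l1_norm u \<le> M" and M: "0 \<le> M"
    and b: "\<And>j. bernstein Q (\<lambda>x. x $ j) \<sigma> K" and K: "0 \<le> K" and \<sigma>: "0 \<le> \<sigma>"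
  shows "(\<integral>y. Max ((\<lambda>u. \<Sum>i\<in>I. y i \<bullet> u) ` F) \<partial>PiM I (\<lambda>_. symmetrize Q))
    \<le> card I * (M * delta (card I) CARD('p) \<sigma> K)"
proof -
  interpret Q: prob_space Q by fact
  define N where "N = symmetrize Q"
  interpret N: prob_space N unfolding N_def by (rule prob_space_symmetrize[OF Q])
  have [measurable_cong]: "sets Q = sets borel" by fact
  let ?T = "\<lambda>y. Max ((\<lambda>j. \<bar>\<Sum>i\<in>I. (y i :: real ^ 'p) $ j\<bar>) ` UNIV)"
  have coordQ: "integrable Q (\<lambda>x. x $ j)" for j
  proof -
    have "(\<lambda>x. x $ j) \<in> borel_measurable Q" by measurable
    then show ?thesis by (rule Q.integrable_of_bernstein[OF _ b])
  qed
  have coordN: "integrable N (\<lambda>x. x $ j)" for j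
    unfolding N_def using coordQ by (intro integrable_symmetrize[OF Q]) auto
  have innerN: "integrable N (\<lambda>x. x \<bullet> u)" for u
    unfolding inner_vec_def using coordN by simp
  have le: "Max ((\<lambda>u. \<Sum>i\<in>I. y i \<bullet> u) ` F) \<le> M * ?T y" for y :: "'a \<Rightarrow> real ^ 'p"
  proof (rule Max.boundedI)
    fix z assume "z \<in> (\<lambda>u. \<Sum>i\<in>I. y i \<bullet> u) ` F"
    then obtain u where u: "u \<in> F" "z = (\<Sum>i\<in>I. y i \<bullet> u)" by auto
    have Tj: "\<bar>\<Sum>i\<in>I. y i $ j\<bar> \<le> ?T y" for j by (rule Max_ge) auto
    have T0: "0 \<le> ?T y" using Tj[of undefined] by linarith
    have "z = (\<Sum>i\<in>I. y i) \<bullet> u" by (simp add: u inner_sum_left)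
    also have "\<dots> = (\<Sum>j\<in>UNIV. (\<Sum>i\<in>I. y i $ j) * u $ j)" by (simp add: inner_vec_def)
    also have "\<dots> \<le> (\<Sum>j\<in>UNIV. ?T y * \<bar>u $ j\<bar>)"
    proof (rule sum_mono)
      fix j
      have "(\<Sum>i\<in>I. y i $ j) * u $ j \<le> \<bar>\<Sum>i\<in>I. y i $ j\<bar> * \<bar>u $ j\<bar>" by (simp flip: abs_mult)
      also have "\<dots> \<le> ?T y * \<bar>u $ j\<bar>" by (intro mult_right_mono Tj) auto
      finally show "(\<Sum>i\<in>I. y i $ j) * u $ j \<le> ?T y * \<bar>u $ j\<bar>" .
    qed
    also have "\<dots> = ?T y * l1_norm u" by (simp add: l1_norm_def sum_distrib_left)
    also have "\<dots> \<le> ?T y * M" by (intro mult_left_mono F(3) u(1) T0)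
    finally show "z \<le> M * ?T y" by (simp add: mult.commute)
  qed (use F in auto)
  have "(\<integral>y. Max ((\<lambda>u. \<Sum>i\<in>I. y i \<bullet> u) ` F) \<partial>PiM I (\<lambda>_. N)) \<le> (\<integral>y. M * ?T y \<partial>PiM I (\<lambda>_. N))"
    by (intro integral_mono le integrable_Max_image F integrable_mult_right integrable_abs
        Bochner_Integration.integrable_sum integrable_PiM_component[OF N.prob_space_axioms] innerN coordN) auto
  also have "\<dots> = M * (\<integral>y. ?T y \<partial>PiM I (\<lambda>_. N))" by simp
  also have "\<dots> \<le> M * (card I * delta (card I) CARD('p) \<sigma> K)"
    unfolding N_def by (intro mult_left_mono M expectation_Max_coordinate_sum_le[OF Q I b K \<sigma>])
  finally show ?thesis by (simp add: N_def algebra_simps)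
qed

section \<open>The lower tail of the quadratic form\<close>

text \<open>The truncated square is the square of \<open>min \<bar>c\<bar> K\<close>, a 1-Lipschitz
  function of \<open>c\<close> with values between 0 and \<open>K\<close>.\<close>

lemma min_square_lipschitz:
  fixes a b K :: real
  assumes "0 \<le> K"
  shows "\<bar>min (a\<^sup>2) (K\<^sup>2) - min (b\<^sup>2) (K\<^sup>2)\<bar> \<le> 2 * K * \<bar>a - b\<bar>"
proof -
  have eq: "min (c\<^sup>2) (K\<^sup>2) = (min \<bar>c\<bar> K)\<^sup>2" for c
    using assms abs_le_square_iff[of c K] abs_le_square_iff[of K c] by (auto simp: min_def)
  let ?p = "min \<bar>a\<bar> K" and ?q = "min \<bar>b\<bar> K"
  have "\<bar>?p\<^sup>2 - ?q\<^sup>2\<bar> = \<bar>?p + ?q\<bar> * \<bar>?p - ?q\<bar>" by (simp add: power2_eq_square square_diff_square_factored abs_mult)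
  also have "\<dots> \<le> (2 * K) * \<bar>a - b\<bar>" using assms by (intro mult_mono) auto
  finally show ?thesis by (simp add: eq)
qed

text \<open>The truncation level \<open>K\<close> balances the fluctuation \<open>K * a\<close> against the bias
  \<open>C powr m * K powr (2 - m)\<close>.\<close>

lemma truncation_level_bound:
  fixes m C a0 x :: real
  assumes m: "m > 2" and C: "C > 0" and a0: "a0 \<ge> 0" and x: "x > 0"
  defines "a \<equiv> 16 * a0 + sqrt (2 * x)"
  defines "K \<equiv> (C powr m / a) powr (1 / (m - 1))"
  shows "4 * K * a0 + 2 * K * sqrt x + K\<^sup>2 * x + 2 * C powr m * K powr (2 - m) / (m - 2)
    \<le> D_const m C * a powr ((m - 2) / (m - 1)) + 8 * (D_const m C)\<^sup>2 / 3 * x powr ((m - 2) / (m - 1))"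
proof -
  have a: "a > 0" unfolding a_def using a0 x by (simp add: add_nonneg_pos)
  have K: "K > 0" unfolding K_def using a C by simp
  define \<alpha> where "\<alpha> = (m - 2) / (m - 1)"
  have \<alpha>: "\<alpha> = 1 - 1 / (m - 1)" using m by (simp add: \<alpha>_def field_simps)
  define E where "E = C powr (m / (m - 1))"
  have E: "E > 0" unfolding E_def using C by simp
  define k where "k = (m - 1) / (m - 2)"
  have k: "k \<ge> 1" "k = 1 + 1 / (m - 2)" using m by (simp_all add: k_def field_simps)
  have D: "D_const m C = 2 powr (m / (m - 1)) * (E * k)"
    unfolding D_const_def E_def k_def using C by (simp add: powr_mult)
  have "(2::real) powr 1 \<le> 2 powr (m / (m - 1))" using m by (intro powr_mono) auto
  then have D2: "2 * (E * k) \<le> D_const m C"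
    unfolding D using E k by (intro mult_right_mono) auto
  have KE: "K = E * a powr (- 1 / (m - 1))"
    unfolding K_def E_def using C a by (simp add: powr_divide powr_powr powr_minus_divide)
  have Ka: "K * a = E * a powr \<alpha>"
    unfolding KE \<alpha> using a by (simp add: powr_diff powr_minus_divide)
  \<comment> \<open>This equation is the reason for the choice of \<open>K\<close>: it turns the
    bias into \<open>2 / (m - 2)\<close> times \<open>K * a\<close>.\<close>
  have "C powr m = a * K powr (m - 1)" unfolding K_def using m C a by (simp add: powr_powr)
  moreover have "K powr (2 - m) = K / K powr (m - 1)"
    using powr_diff[of K 1 "m - 1"] K by simp
  ultimately have bias: "C powr m * K powr (2 - m) = K * a" using K by simp
  have "sqrt x \<le> sqrt (2 * x)" using x by simp
  \<comment> \<open>The factor 16 leaves ample room: only 4 of the 32 copies of \<open>a0\<close> on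
    the right are used.\<close>
  moreover have "4 * a0 + 2 * p \<le> 2 * (16 * a0 + q)" if "p \<le> q" for p q :: real
    using that a0 by simp
  ultimately have "4 * a0 + 2 * sqrt x \<le> 2 * a" unfolding a_def by blast
  from mult_left_mono[OF this, of K] have "4 * K * a0 + 2 * K * sqrt x \<le> 2 * (K * a)"
    using K by (simp add: algebra_simps)
  moreover have "2 * C powr m * K powr (2 - m) / (m - 2) = 2 * (K * a) / (m - 2)"
    using bias by (simp only: mult.assoc)
  ultimately have "4 * K * a0 + 2 * K * sqrt x + 2 * C powr m * K powr (2 - m) / (m - 2)
      \<le> 2 * (K * a) + 2 * (K * a) / (m - 2)" by (simp only: add_mono order_refl)
  also have "\<dots> = 2 * (K * a) * k" unfolding k(2) by (simp add: algebra_simps)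
  also have "\<dots> = 2 * (E * k) * a powr \<alpha>" by (simp add: Ka)
  also have "\<dots> \<le> D_const m C * a powr \<alpha>" using D2 by (intro mult_right_mono) auto
  finally have part1: "4 * K * a0 + 2 * K * sqrt x + 2 * C powr m * K powr (2 - m) / (m - 2)
      \<le> D_const m C * a powr \<alpha>" .
  \<comment> \<open>\<open>K\<close> is a decreasing power of \<open>a\<close>, so a lower bound on
    \<open>a\<close> is wanted. Taking it from \<open>sqrt (2 * x)\<close> alone makes the last term
    depend on \<open>x\<close> only.\<close>
  have "x \<le> (sqrt (2 * x))\<^sup>2" using x by simp
  also have "\<dots> \<le> a\<^sup>2" unfolding a_def using a0 x by (intro power_mono) auto
  finally have xa: "x \<le> a\<^sup>2" .
  have "K\<^sup>2 = E\<^sup>2 * (a powr (- 1 / (m - 1)))\<^sup>2" by (simp add: KE power_mult_distrib)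
  also have "(a powr (- 1 / (m - 1)))\<^sup>2 = (a\<^sup>2) powr (- 1 / (m - 1))"
    using a by (simp add: power2_eq_square powr_mult)
  also have "\<dots> \<le> x powr (- 1 / (m - 1))" using m x xa by (intro powr_mono2') auto
  finally have "K\<^sup>2 * x \<le> E\<^sup>2 * x powr (- 1 / (m - 1)) * x"
    using x by (simp add: mult_left_mono mult_right_mono)
  also have "\<dots> = E\<^sup>2 * x powr \<alpha>"
    unfolding \<alpha> using x by (simp add: powr_diff powr_minus_divide)
  also have "\<dots> \<le> 8 * (D_const m C)\<^sup>2 / 3 * x powr \<alpha>"
  proof (intro mult_right_mono)
    have "E * 1 \<le> E * k" using E k by (intro mult_left_mono) auto
    moreover have "0 \<le> E * k" using E k by simp
    ultimately have "E \<le> D_const m C" using D2 by linarith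
    then have "E\<^sup>2 \<le> (D_const m C)\<^sup>2" using E by (intro power_mono) auto
    moreover have "0 \<le> (D_const m C)\<^sup>2" by simp
    ultimately show "E\<^sup>2 \<le> 8 * (D_const m C)\<^sup>2 / 3" by linarith
  qed simp
  finally show ?thesis using part1 by (simp add: \<alpha>_def)
qed

text \<open>The two parts of the theorem differ only in \<open>a0\<close>, the bound per row on the
  mean maximum of the linear process. Truncation, concentration and bias are common to both and are
  combined here.\<close>

lemma quadratic_form_lower_tail_finite:
  fixes Q :: "'x::euclidean_space measure" and F :: "'x set" and I :: "'i set" and m C a0 t :: real
  assumes Q: "prob_space Q" "sets Q = sets borel" and I: "finite I" "I \<noteq> {}" and F: "finite F" "F \<noteq> {}"
    and sq: "\<And>u. integrable Q (\<lambda>x. (x \<bullet> u)\<^sup>2)"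
    and one: "\<And>u. u \<in> F \<Longrightarrow> (\<integral>x. (x \<bullet> u)\<^sup>2 \<partial>Q) = 1"
    and tail: "\<And>u s. u \<in> F \<Longrightarrow> s > 0 \<Longrightarrow> measure Q {x \<in> space Q. \<bar>x \<bullet> u\<bar> > s} \<le> (C / s) powr m"
    and m: "m > 2" and C: "C > 0"
    and a0: "(\<integral>y. Max ((\<lambda>u. \<Sum>i\<in>I. y i \<bullet> u) ` F) \<partial>PiM I (\<lambda>_. symmetrize Q)) \<le> card I * a0" "0 \<le> a0"
    and t: "t > 0"
  defines "N \<equiv> PiM I (\<lambda>_. Q)" and "n \<equiv> real (card I)"
  defines "\<beta> \<equiv> D_const m C * (16 * a0 + sqrt (2 * t / n)) powr ((m - 2) / (m - 1))
      + 8 * (D_const m C)\<^sup>2 / 3 * (t / n) powr ((m - 2) / (m - 1))"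
  shows "1 - exp (- t) \<le> measure N {y \<in> space N. \<forall>u\<in>F. 1 - \<beta> \<le> 1 / n * (\<Sum>i\<in>I. (y i \<bullet> u)\<^sup>2)}"
proof -
  interpret Q: prob_space Q by fact
  interpret N: prob_space N unfolding N_def by (intro prob_space_PiM Q)
  define S where "S = symmetrize Q"
  interpret S: prob_space S unfolding S_def by (rule prob_space_symmetrize[OF Q])
  have [measurable_cong]: "sets Q = sets borel" by fact
  have inner_meas[measurable]: "(\<lambda>x. x \<bullet> u) \<in> borel_measurable Q" for u by measurable
  have n: "n > 0" unfolding n_def using I by (simp add: card_gt_0_iff)
  define a where "a = 16 * a0 + sqrt (2 * (t / n))"
  have a: "a > 0" unfolding a_def using a0 t n by (simp add: add_nonneg_pos)
  define K where "K = (C powr m / a) powr (1 / (m - 1))"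
  have K: "K > 0" unfolding K_def using a C by simp
  define f where "f = (\<lambda>u (x :: 'x). min ((x \<bullet> u)\<^sup>2) (K\<^sup>2))"
  have f_meas[measurable]: "f u \<in> borel_measurable Q" for u unfolding f_def by measurable
  have f: "0 \<le> f u x" "f u x \<le> K\<^sup>2" "f u x \<le> (x \<bullet> u)\<^sup>2" for u x by (auto simp: f_def)
  have f_int: "integrable Q (f u)" for u
    by (rule Q.integrable_const_bound[of _ "K\<^sup>2"]) (use f in auto)
  have int1: "integrable Q (\<lambda>x. x \<bullet> u)" for u
    by (rule Q.integrable_of_integrable_square[OF inner_meas sq])
  have v: "(\<integral>x. (f u x)\<^sup>2 \<partial>Q) \<le> K\<^sup>2" if "u \<in> F" for u
  proof -
    \<comment> \<open>One factor is bounded by the truncation level and the other by the untruncated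
      square, so the unit second moment is enough and no fourth moment appears.\<close>
    have le: "(f u x)\<^sup>2 \<le> K\<^sup>2 * (x \<bullet> u)\<^sup>2" for x
      unfolding power2_eq_square[of "f u x"] using f by (intro mult_mono) auto
    have "integrable Q (\<lambda>x. (f u x)\<^sup>2)"
      by (rule Bochner_Integration.integrable_bound[OF integrable_mult_right[OF sq, of "K\<^sup>2"]]) (use le in auto)
    then have "(\<integral>x. (f u x)\<^sup>2 \<partial>Q) \<le> (\<integral>x. K\<^sup>2 * (x \<bullet> u)\<^sup>2 \<partial>Q)"
      using sq le by (intro integral_mono) auto
    then show ?thesis using one[OF that] by simp
  qed
  define e where "e = (\<lambda>u. \<integral>x. f u x \<partial>Q)"
  have bias: "1 - 2 * C powr m * K powr (2 - m) / (m - 2) \<le> e u" if "u \<in> F" for u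
  proof -
    have "1 - e u = (\<integral>x. (x \<bullet> u)\<^sup>2 - min ((x \<bullet> u)\<^sup>2) (K\<^sup>2) \<partial>Q)"
      using sq f_int[of u] one[OF that] by (simp add: e_def f_def)
    also have "\<dots> \<le> 2 * C powr m * K powr (2 - m) / (m - 2)"
      by (rule truncation_bias[OF Q(1) inner_meas sq tail[OF that] m C K])
    finally show ?thesis by simp
  qed
  define Z where "Z = (\<lambda>y. Max ((\<lambda>u. n * e u - (\<Sum>i\<in>I. f u (y i))) ` F))"
  have Z_eq: "Z y = Max ((\<lambda>u. 0 + (\<Sum>i\<in>I. e u - f u (y i))) ` F)" for y
    by (simp add: Z_def n_def sum_subtractf)
  have EZ: "(\<integral>y. Z y \<partial>N) \<le> 4 * K * (n * a0)"
  proof -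
    have intN: "integrable S (\<lambda>x. x \<bullet> u)" for u
      unfolding S_def using int1 by (intro integrable_symmetrize[OF Q]) auto
    have intM: "integrable (PiM I (\<lambda>_. S)) (\<lambda>y. Max ((\<lambda>u. \<Sum>i\<in>I. y i \<bullet> u) ` F))"
      by (intro integrable_Max_image F Bochner_Integration.integrable_sum
          integrable_PiM_component[OF S.prob_space_axioms _ intN])
    \<comment> \<open>In \<open>2 * (2 * K)\<close> the outer 2 comes from symmetrization and
      \<open>2 * K\<close> is the Lipschitz constant of the truncated square.\<close>
    have "(\<integral>y. Z y \<partial>N) \<le> (\<integral>y. Max ((\<lambda>u. 0 + (\<Sum>i\<in>I. 2 * (2 * K) * (y i \<bullet> u))) ` F) \<partial>PiM I (\<lambda>_. S))"
      unfolding Z_eq N_def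
    proof (rule expectation_Max_PiM_mono[OF Q(1) S.prob_space_axioms F I(1)])
      show "integrable Q (\<lambda>x. e u - f u x)" for u using f_int by simp
      show "integrable S (\<lambda>x. 2 * (2 * K) * (x \<bullet> u))" for u using intN by simp
      show "(\<integral>x. Max ((\<lambda>u. g u + (e u - f u x)) ` F) \<partial>Q)
          \<le> (\<integral>x. Max ((\<lambda>u. g u + 2 * (2 * K) * (x \<bullet> u)) ` F) \<partial>S)" for g
        unfolding e_def S_def
        by (rule expectation_Max_le_symmetrize[OF Q F f_int int1])
          (use K min_square_lipschitz[of K] in \<open>simp add: f_def\<close>)
    qed
    also have "\<dots> \<le> (\<integral>y. 4 * K * Max ((\<lambda>u. \<Sum>i\<in>I. y i \<bullet> u) ` F) \<partial>PiM I (\<lambda>_. S))"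
    proof (rule integral_mono)
      show "integrable (PiM I (\<lambda>_. S)) (\<lambda>y. Max ((\<lambda>u. 0 + (\<Sum>i\<in>I. 2 * (2 * K) * (y i \<bullet> u))) ` F))"
        by (rule integrable_Max_PiM[OF S.prob_space_axioms F]) (use intN in auto)
      show "integrable (PiM I (\<lambda>_. S)) (\<lambda>y. 4 * K * Max ((\<lambda>u. \<Sum>i\<in>I. y i \<bullet> u) ` F))"
        using intM by simp
      show "Max ((\<lambda>u. 0 + (\<Sum>i\<in>I. 2 * (2 * K) * (y i \<bullet> u))) ` F)
          \<le> 4 * K * Max ((\<lambda>u. \<Sum>i\<in>I. y i \<bullet> u) ` F)" for y
      proof (rule Max.boundedI)
        fix z assume "z \<in> (\<lambda>u. 0 + (\<Sum>i\<in>I. 2 * (2 * K) * (y i \<bullet> u))) ` F"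
        then obtain u where u: "u \<in> F" "z = 4 * K * (\<Sum>i\<in>I. y i \<bullet> u)"
          by (auto simp: sum_distrib_left)
        show "z \<le> 4 * K * Max ((\<lambda>u. \<Sum>i\<in>I. y i \<bullet> u) ` F)"
          unfolding u(2) using K F u(1) by (intro mult_left_mono Max_ge) auto
      qed (use F in auto)
    qed
    also have "\<dots> \<le> 4 * K * (n * a0)"
      using a0(1) K by (simp add: S_def n_def)
    finally show ?thesis .
  qed
  \<comment> \<open>The level given by \<open>Max_PiM_tail\<close> when \<open>K\<^sup>2\<close>
    serves both as the range \<open>b\<close> and as the variance bound \<open>v\<close>.\<close>
  define \<tau> where "\<tau> = (\<integral>y. Z y \<partial>N) + 2 * sqrt (n * K\<^sup>2 * t) + K\<^sup>2 * t"
  have Z_meas[measurable]: "Z \<in> borel_measurable N"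
    unfolding Z_def N_def
  proof (intro borel_measurable_Max F)
    fix u show "(\<lambda>y. n * e u - (\<Sum>i\<in>I. f u (y i))) \<in> borel_measurable (PiM I (\<lambda>_. Q))" by measurable
  qed
  have "measure N {y \<in> space N. Z y \<ge> \<tau>} \<le> exp (- t)"
    using Max_PiM_tail[OF Q(1) I F f_meas f(1,2) v _ t, where g = "\<lambda>u. n * e u"] K
    by (simp add: Z_def N_def n_def \<tau>_def)
  then have "1 - exp (- t) \<le> 1 - measure N {y \<in> space N. Z y \<ge> \<tau>}" by simp
  also have "\<dots> = measure N {y \<in> space N. \<not> Z y \<ge> \<tau>}"
    by (rule N.prob_neg[symmetric]) measurable
  also have "\<dots> \<le> measure N {y \<in> space N. \<forall>u\<in>F. 1 - \<beta> \<le> 1 / n * (\<Sum>i\<in>I. (y i \<bullet> u)\<^sup>2)}"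
  proof (rule N.finite_measure_mono)
    show "{y \<in> space N. \<forall>u\<in>F. 1 - \<beta> \<le> 1 / n * (\<Sum>i\<in>I. (y i \<bullet> u)\<^sup>2)} \<in> sets N"
      using F(1) unfolding N_def by measurable
    show "{y \<in> space N. \<not> Z y \<ge> \<tau>} \<subseteq> {y \<in> space N. \<forall>u\<in>F. 1 - \<beta> \<le> 1 / n * (\<Sum>i\<in>I. (y i \<bullet> u)\<^sup>2)}"
    proof safe
      fix y u assume y: "\<not> Z y \<ge> \<tau>" and u: "u \<in> F"
      have "n * e u - (\<Sum>i\<in>I. f u (y i)) \<le> Z y" unfolding Z_def using F u by (intro Max_ge) auto
      also have "Z y \<le> \<tau>" using y by simp
      also have "\<tau> \<le> 4 * K * (n * a0) + 2 * sqrt (n * K\<^sup>2 * t) + K\<^sup>2 * t" unfolding \<tau>_def using EZ by simp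
      also have "sqrt (n * K\<^sup>2 * t) = n * (K * sqrt (t / n))"
      proof -
        have "n * K\<^sup>2 * t = (n * K)\<^sup>2 * (t / n)" using n by (simp add: power2_eq_square)
        then show ?thesis using n K by (simp only: real_sqrt_mult real_sqrt_abs) simp
      qed
      finally have "n * e u - (\<Sum>i\<in>I. f u (y i)) \<le> n * (4 * K * a0 + 2 * K * sqrt (t / n) + K\<^sup>2 * (t / n))"
        using n by (simp add: algebra_simps)
      then have "n * (e u - (4 * K * a0 + 2 * K * sqrt (t / n) + K\<^sup>2 * (t / n))) \<le> (\<Sum>i\<in>I. f u (y i))"
        by (simp add: algebra_simps)
      also have "\<dots> \<le> (\<Sum>i\<in>I. (y i \<bullet> u)\<^sup>2)" by (intro sum_mono f(3))
      finally have "e u - (4 * K * a0 + 2 * K * sqrt (t / n) + K\<^sup>2 * (t / n)) \<le> 1 / n * (\<Sum>i\<in>I. (y i \<bullet> u)\<^sup>2)"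
        using n by (simp add: field_simps)
      moreover have "4 * K * a0 + 2 * K * sqrt (t / n) + K\<^sup>2 * (t / n)
          + 2 * C powr m * K powr (2 - m) / (m - 2) \<le> \<beta>"
        using truncation_level_bound[OF m C a0(2), of "t / n"] t n by (simp add: \<beta>_def K_def a_def)
      ultimately show "1 - \<beta> \<le> 1 / n * (\<Sum>i\<in>I. (y i \<bullet> u)\<^sup>2)" using bias[OF u] by linarith
    qed
  qed
  finally show ?thesis .
qed

text \<open>A countable dense subset of \<open>U\<close>, exhausted by finite sets, has the same infimum.\<close>

lemma prob_INF_emp_norm_sq_ge:
  fixes X :: "'w \<Rightarrow> real ^ 'p ^ 'n" and U :: "(real ^ 'p) set" and \<beta> q :: real
  assumes P: "prob_space P" and X: "\<And>i. (\<lambda>\<omega>. X \<omega> $ i) \<in> borel_measurable P" and q: "q \<le> 1"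
    and fin: "\<And>F. finite F \<Longrightarrow> F \<noteq> {} \<Longrightarrow> F \<subseteq> U \<Longrightarrow>
      q \<le> measure P {\<omega> \<in> space P. \<forall>u\<in>F. 1 - \<beta> \<le> emp_norm_sq (X \<omega> *v u)}"
  shows "q \<le> measure P {\<omega> \<in> space P. (INF u\<in>U. ereal (emp_norm_sq (X \<omega> *v u))) - 1 \<ge> ereal (- \<beta>)}"
proof -
  interpret P: prob_space P by fact
  \<comment> \<open>In \<open>ereal\<close> the infimum over the empty set is \<infinity>, so the
    equivalence covers every \<open>U\<close>. An empty \<open>U\<close> does occur, for instance
    when all second moments vanish.\<close>
  have ev: "(INF u\<in>U. ereal (emp_norm_sq (X \<omega> *v u))) - 1 \<ge> ereal (- \<beta>)
      \<longleftrightarrow> (\<forall>u\<in>U. 1 - \<beta> \<le> emp_norm_sq (X \<omega> *v u))" for \<omega>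
  proof -
    have "(INF u\<in>U. ereal (emp_norm_sq (X \<omega> *v u))) - 1 \<ge> ereal (- \<beta>)
        \<longleftrightarrow> ereal (1 - \<beta>) \<le> (INF u\<in>U. ereal (emp_norm_sq (X \<omega> *v u)))"
      by (subst ereal_le_minus) (auto simp: one_ereal_def)
    then show ?thesis by (simp add: le_INF_iff)
  qed
  have emp: "emp_norm_sq (A *v u) = 1 / real CARD('n) * (\<Sum>i\<in>UNIV. (A $ i \<bullet> u)\<^sup>2)"
    for A :: "real ^ 'p ^ 'n" and u
    by (simp add: emp_norm_sq_def matrix_vector_mul_component)
  show ?thesis
  proof (cases "U = {}")
    case True
    then show ?thesis unfolding ev using q by (simp add: P.prob_space)
  next
    case False
    obtain T where T: "countable T" "T \<subseteq> U" "U \<subseteq> closure T" by (rule separable[of U])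
    have T0: "T \<noteq> {}" using False T(3) by auto
    \<comment> \<open>Prefixes of an enumeration of \<open>T\<close>, with repetitions if
      \<open>T\<close> is finite. The events decrease, so continuity of the measure from above
      carries the uniform bound \<open>q\<close> to their intersection.\<close>
    define A where "A = (\<lambda>k. {\<omega> \<in> space P. \<forall>u\<in>from_nat_into T ` {..k}. 1 - \<beta> \<le> emp_norm_sq (X \<omega> *v u)})"
    have "(\<lambda>k. measure P (A k)) \<longlonglongrightarrow> measure P (\<Inter>k. A k)"
    proof (rule P.finite_Lim_measure_decseq)
      note [measurable] = X
      have "A k \<in> sets P" for k
      proof -
        have [simp]: "finite (from_nat_into T ` {..k})" by simp
        show ?thesis unfolding A_def emp by measurable
      qed
      then show "range A \<subseteq> sets P" by auto
      show "decseq A" unfolding decseq_def A_def by force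
    qed
    moreover have "q \<le> measure P (A k)" for k
      unfolding A_def using from_nat_into[OF T0] T(2) by (intro fin) auto
    ultimately have "q \<le> measure P (\<Inter>k. A k)" by (intro LIMSEQ_le_const) auto
    also have "(\<Inter>k. A k) = {\<omega> \<in> space P. \<forall>u\<in>U. 1 - \<beta> \<le> emp_norm_sq (X \<omega> *v u)}" (is "?L = ?R")
    proof
      show "?R \<subseteq> ?L" unfolding A_def using from_nat_into[OF T0] T(2) by auto
      show "?L \<subseteq> ?R"
      proof
        fix \<omega> assume w: "\<omega> \<in> ?L"
        have "1 - \<beta> \<le> emp_norm_sq (X \<omega> *v u)" if uT: "u \<in> T" for u
        proof -
          obtain k where k: "from_nat_into T k = u" using from_nat_into_surj[OF T(1) uT] by auto
          have "\<omega> \<in> A k" using w by simp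
          then show ?thesis unfolding A_def using k by auto
        qed
        then have "T \<subseteq> {u. 1 - \<beta> \<le> emp_norm_sq (X \<omega> *v u)}" by auto
        \<comment> \<open>The empirical norm is continuous in \<open>u\<close>, so a bound on
          \<open>T\<close> extends to its closure and thus to \<open>U\<close>.\<close>
        moreover have "closed {u. 1 - \<beta> \<le> emp_norm_sq (X \<omega> *v u)}"
          unfolding emp by (intro closed_Collect_le continuous_intros)
        ultimately have "closure T \<subseteq> {u. 1 - \<beta> \<le> emp_norm_sq (X \<omega> *v u)}" by (rule closure_minimal)
        moreover have "\<omega> \<in> space P" using w by (simp add: A_def)
        ultimately show "\<omega> \<in> ?R" using T(3) by auto
      qed
    qed
    finally show ?thesis unfolding ev .
  qed
qed

text \<open>Excludes the degenerate constant \<open>C = 0\<close>: all tails then vanish, which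
  contradicts a unit second moment.\<close>

lemma (in prob_space) second_moment_zero_of_tails:
  fixes Z :: "'a \<Rightarrow> real"
  assumes [measurable]: "Z \<in> borel_measurable M"
    and tail: "\<And>t. t > 0 \<Longrightarrow> prob {x \<in> space M. \<bar>Z x\<bar> > t} = 0"
  shows "expectation (\<lambda>x. (Z x)\<^sup>2) = 0"
proof -
  have "AE x in M. \<bar>Z x\<bar> \<le> 1 / real (Suc k)" for k
  proof -
    have "prob {x \<in> space M. \<bar>Z x\<bar> > 1 / real (Suc k)} = 0" by (rule tail) simp
    then have "AE x in M. \<not> \<bar>Z x\<bar> > 1 / real (Suc k)"
      by (subst (asm) prob_eq_0) (auto elim: eventually_mono)
    then show ?thesis by (simp add: not_less)
  qed
  then have "AE x in M. \<forall>k. \<bar>Z x\<bar> \<le> 1 / real (Suc k)" by (simp add: AE_all_countable)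
  then have "AE x in M. (Z x)\<^sup>2 = 0"
  proof eventually_elim
    case (elim x)
    show ?case
    proof (rule ccontr)
      assume "(Z x)\<^sup>2 \<noteq> 0"
      then obtain k where "1 / real (Suc k) < \<bar>Z x\<bar>" using nat_approx_posE[of "\<bar>Z x\<bar>"] by auto
      with elim show False by (metis not_less)
    qed
  qed
  then have "expectation (\<lambda>x. (Z x)\<^sup>2) = expectation (\<lambda>x. 0)" by (intro integral_cong_AE) auto
  then show ?thesis by simp
qed

theorem theorem3p1:
  fixes P0 :: "'a measure" and X0 :: "'a \<Rightarrow> real ^ 'p"
    and P :: "'w measure" and X :: "'w \<Rightarrow> real ^ 'p ^ 'n"
    and m C :: real
  assumes "prob_space P0" and "X0 \<in> borel_measurable P0"
    and "second_moment_exists P0 X0"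
    and "prob_space P"
    and rows_indep: "prob_space.indep_vars P (\<lambda>_. borel) (\<lambda>i \<omega>. X \<omega> $ i) UNIV"
    and rows_copies: "\<And>i. distr P borel (\<lambda>\<omega>. X \<omega> $ i) = distr P0 borel X0"
    and "m > 2" and "C \<ge> 0" and "weakly_isotropic P0 X0 m C"
  shows "(\<forall>t>0. measure P {\<omega> \<in> space P.
            (INF u\<in>{u. Lnorm P0 2 (\<lambda>x. X0 x \<bullet> u) = 1}. ereal (emp_norm_sq (X \<omega> *v u))) - 1
              \<ge> ereal (- (D_const m C
                    * (16 * sqrt (real CARD('p) / real CARD('n)) + sqrt (2 * t / real CARD('n)))
                        powr ((m - 2) / (m - 1))
                  + 8 * (D_const m C)\<^sup>2 / 3 * (t / real CARD('n)) powr ((m - 2) / (m - 1))))}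
          \<ge> 1 - exp (- t))
    \<and> (\<forall>\<sigma>\<ge>0. \<forall>K\<ge>0. (\<forall>j. bernstein P0 (\<lambda>x. X0 x $ j) \<sigma> K) \<longrightarrow>
        (\<forall>M\<ge>1. \<forall>t>0. measure P {\<omega> \<in> space P.
            (INF u\<in>{u. Lnorm P0 2 (\<lambda>x. X0 x \<bullet> u) = 1 \<and> l1_norm u \<le> M}.
                ereal (emp_norm_sq (X \<omega> *v u))) - 1
              \<ge> ereal (- Delta_L CARD('n) CARD('p) m C \<sigma> K M t)}
          \<ge> 1 - exp (- t)))"
proof -
  interpret P0: prob_space P0 by fact
  interpret P: prob_space P by fact
  note [measurable] = \<open>X0 \<in> borel_measurable P0\<close>
  define Q where "Q = distr P0 borel X0"
  interpret Q: prob_space Q unfolding Q_def by (rule P0.prob_space_distr) measurable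
  have Q: "prob_space Q" "sets Q = sets borel" by (simp_all add: Q.prob_space_axioms) (simp add: Q_def)
  have X: "(\<lambda>\<omega>. X \<omega> $ i) \<in> borel_measurable P" for i
    using rows_indep by (auto simp: P.indep_vars_def)
  \<comment> \<open>Independence with a common law, rewritten as a product measure, is the form in
    which the bound for finite sets applies.\<close>
  have law: "distr P (PiM UNIV (\<lambda>_. borel)) (\<lambda>\<omega> i. X \<omega> $ i) = PiM UNIV (\<lambda>_::'n. Q)"
    using rows_indep P.indep_vars_iff_distr_eq_PiM[where I = UNIV and M' = "\<lambda>_. borel" and X = "\<lambda>i \<omega>. X \<omega> $ i"] X rows_copies
    by (simp add: Q_def restrict_UNIV)
  have comp: "integrable P0 (\<lambda>x. X0 x $ j * X0 x $ k)" for j k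
  proof -
    have "integrable P0 (\<lambda>x. (\<chi> j k. X0 x $ j * X0 x $ k) $ j $ k)"
      using \<open>second_moment_exists P0 X0\<close> unfolding second_moment_exists_def
      by (intro integrable_bounded_linear[OF bounded_linear_vec_nth])
    then show ?thesis by simp
  qed
  have sq0: "integrable P0 (\<lambda>x. (X0 x \<bullet> u)\<^sup>2)" for u
  proof -
    have eq: "(\<lambda>x. (X0 x \<bullet> u)\<^sup>2) = (\<lambda>x. \<Sum>j\<in>UNIV. \<Sum>k\<in>UNIV. u $ j * u $ k * (X0 x $ j * X0 x $ k))"
      by (simp add: inner_vec_def power2_eq_square sum_product mult_ac)
    show ?thesis unfolding eq using comp by simp
  qed
  have sq: "integrable Q (\<lambda>x. (x \<bullet> u)\<^sup>2)" for u
    unfolding Q_def using sq0 by (subst integrable_distr_eq) auto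
  let ?U = "{u. Lnorm P0 2 (\<lambda>x. X0 x \<bullet> u) = 1}"
  have one0: "(\<integral>x. (X0 x \<bullet> u)\<^sup>2 \<partial>P0) = 1" if "u \<in> ?U" for u
  proof -
    have "\<bar>z\<bar> powr 2 = z\<^sup>2" for z :: real by (cases "z = 0") auto
    then have "sqrt (\<integral>x. (X0 x \<bullet> u)\<^sup>2 \<partial>P0) = 1"
      using that by (simp add: Lnorm_def powr_half_sqrt)
    then show ?thesis by simp
  qed
  have one: "(\<integral>x. (x \<bullet> u)\<^sup>2 \<partial>Q) = 1" if "u \<in> ?U" for u
    unfolding Q_def using one0[OF that] by (subst integral_distr) auto
  have tail0: "measure P0 {x \<in> space P0. \<bar>X0 x \<bullet> u\<bar> > s} \<le> (C / s) powr m" if "u \<in> ?U" "s > 0" for u s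
    using \<open>weakly_isotropic P0 X0 m C\<close> that by (auto simp: weakly_isotropic_def)
  have tail: "measure Q {x \<in> space Q. \<bar>x \<bullet> u\<bar> > s} \<le> (C / s) powr m" if "u \<in> ?U" "s > 0" for u s
  proof -
    have "measure Q {x \<in> space Q. \<bar>x \<bullet> u\<bar> > s} = measure P0 (X0 -` {x. \<bar>x \<bullet> u\<bar> > s} \<inter> space P0)"
      unfolding Q_def by (subst measure_distr) auto
    also have "X0 -` {x. \<bar>x \<bullet> u\<bar> > s} \<inter> space P0 = {x \<in> space P0. \<bar>X0 x \<bullet> u\<bar> > s}" by auto
    finally show ?thesis using tail0[OF that] by simp
  qed
  \<comment> \<open>The theorem admits \<open>C = 0\<close>, whereas the truncation level needs
    \<open>C > 0\<close>. Any direction of unit norm yields it, and a nonempty finite set supplies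
    one.\<close>
  have C: "C > 0" if "u \<in> ?U" for u
  proof (rule ccontr)
    assume "\<not> C > 0"
    then have "C = 0" using \<open>C \<ge> 0\<close> by simp
    then have "measure P0 {x \<in> space P0. \<bar>X0 x \<bullet> u\<bar> > s} = 0" if "s > 0" for s
      using tail0[OF \<open>u \<in> ?U\<close> that] by (simp add: measure_le_0_iff)
    then have "(\<integral>x. (X0 x \<bullet> u)\<^sup>2 \<partial>P0) = 0" by (intro P0.second_moment_zero_of_tails) auto
    with one0[OF that] show False by simp
  qed
  \<comment> \<open>\<open>W\<close> is either the whole unit set or its part of bounded l1 norm;
    \<open>width\<close> is the input specific to each.\<close>
  have core: "1 - exp (- t) \<le> measure P {\<omega> \<in> space P. (INF u\<in>W. ereal (emp_norm_sq (X \<omega> *v u))) - 1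
      \<ge> ereal (- (D_const m C * (16 * a0 + sqrt (2 * t / real CARD('n))) powr ((m - 2) / (m - 1))
          + 8 * (D_const m C)\<^sup>2 / 3 * (t / real CARD('n)) powr ((m - 2) / (m - 1))))}"
    if W: "W \<subseteq> ?U" and a0: "0 \<le> a0" and t: "t > 0"
      and width: "\<And>F. finite F \<Longrightarrow> F \<noteq> {} \<Longrightarrow> F \<subseteq> W \<Longrightarrow>
        (\<integral>y. Max ((\<lambda>u. \<Sum>i\<in>UNIV. y i \<bullet> u) ` F) \<partial>PiM (UNIV :: 'n set) (\<lambda>_. symmetrize Q)) \<le> real CARD('n) * a0"
    for W and a0 t :: real
  proof (rule prob_INF_emp_norm_sq_ge[OF \<open>prob_space P\<close> X])
    fix F assume F: "finite F" "F \<noteq> {}" "F \<subseteq> W"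
    let ?\<beta> = "D_const m C * (16 * a0 + sqrt (2 * t / real CARD('n))) powr ((m - 2) / (m - 1))
          + 8 * (D_const m C)\<^sup>2 / 3 * (t / real CARD('n)) powr ((m - 2) / (m - 1))"
    let ?N = "PiM UNIV (\<lambda>_::'n. Q)"
    let ?G = "{y \<in> space ?N. \<forall>u\<in>F. 1 - ?\<beta> \<le> 1 / real CARD('n) * (\<Sum>i\<in>UNIV. (y i \<bullet> u)\<^sup>2)}"
    have FU: "u \<in> ?U" if "u \<in> F" for u using that F W by auto
    obtain u where "u \<in> F" using F by auto
    have "1 - exp (- t) \<le> measure ?N ?G"
      by (rule quadratic_form_lower_tail_finite[OF Q _ _ F(1,2) sq one[OF FU] tail[OF FU]
          \<open>m > 2\<close> C[OF FU[OF \<open>u \<in> F\<close>]] width[OF F] a0 t]) auto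
    also have "measure ?N ?G = measure P ((\<lambda>\<omega> i. X \<omega> $ i) -` ?G \<inter> space P)"
    proof -
      \<comment> \<open>\<open>Q\<close> and \<open>borel\<close> share their measurable sets but
        are different measures, so the event is transported to the product of \<open>borel\<close>,
        the target space in \<open>law\<close>.\<close>
      have G: "?G \<in> sets (PiM UNIV (\<lambda>_::'n. borel))"
      proof -
        have s: "sets ?N = sets (PiM UNIV (\<lambda>_::'n. borel))" by (intro sets_PiM_cong) (simp_all add: Q(2))
        have "{y \<in> space (PiM UNIV (\<lambda>_::'n. borel)). \<forall>u\<in>F. 1 - ?\<beta> \<le> 1 / real CARD('n) * (\<Sum>i\<in>UNIV. (y i \<bullet> u)\<^sup>2)}
            \<in> sets (PiM UNIV (\<lambda>_::'n. borel))"
          using F(1) by measurable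
        then show ?thesis using sets_eq_imp_space_eq[OF s] by simp
      qed
      have mX: "(\<lambda>\<omega> i. X \<omega> $ i) \<in> P \<rightarrow>\<^sub>M PiM UNIV (\<lambda>_::'n. borel)"
        using X by (intro measurable_PiM_single') auto
      show ?thesis unfolding law[symmetric] using measure_distr[OF mX G] by (simp add: law)
    qed
    also have "(\<lambda>\<omega> i. X \<omega> $ i) -` ?G \<inter> space P = {\<omega> \<in> space P. \<forall>u\<in>F. 1 - ?\<beta> \<le> emp_norm_sq (X \<omega> *v u)}"
      by (auto simp: emp_norm_sq_def matrix_vector_mul_component space_PiM Q_def)
    finally show "1 - exp (- t) \<le> measure P {\<omega> \<in> space P. \<forall>u\<in>F. 1 - ?\<beta> \<le> emp_norm_sq (X \<omega> *v u)}" .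
  qed simp
  show ?thesis
  proof (intro conjI allI impI)
    fix t :: real assume t: "t > 0"
    show "1 - exp (- t) \<le> measure P {\<omega> \<in> space P.
        (INF u\<in>?U. ereal (emp_norm_sq (X \<omega> *v u))) - 1
          \<ge> ereal (- (D_const m C
              * (16 * sqrt (real CARD('p) / real CARD('n)) + sqrt (2 * t / real CARD('n))) powr ((m - 2) / (m - 1))
              + 8 * (D_const m C)\<^sup>2 / 3 * (t / real CARD('n)) powr ((m - 2) / (m - 1))))}"
    proof (rule core[OF order_refl _ t])
      fix F assume F: "finite F" "F \<noteq> {}" "F \<subseteq> ?U"
      have "(\<integral>y. Max ((\<lambda>u. \<Sum>i\<in>UNIV. y i \<bullet> u) ` F) \<partial>PiM (UNIV :: 'n set) (\<lambda>_. symmetrize Q))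
          \<le> sqrt (real (card (UNIV :: 'n set) * DIM(real ^ 'p)))"
        by (rule expectation_Max_inner_sum_le[OF Q F(1,2) _ _ sq]) (use one F in auto)
      also have "\<dots> = CARD('n) * sqrt (real CARD('p) / real CARD('n))"
        by (simp add: real_sqrt_mult real_sqrt_divide real_div_sqrt field_simps)
      finally show "(\<integral>y. Max ((\<lambda>u. \<Sum>i\<in>UNIV. y i \<bullet> u) ` F) \<partial>PiM (UNIV :: 'n set) (\<lambda>_. symmetrize Q))
          \<le> CARD('n) * sqrt (real CARD('p) / real CARD('n))" .
    qed simp
  next
    fix \<sigma> K M t :: real
    assume \<sigma>: "0 \<le> \<sigma>" and K: "0 \<le> K" and b: "\<forall>j. bernstein P0 (\<lambda>x. X0 x $ j) \<sigma> K"
      and M: "1 \<le> M" and t: "t > 0"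
    have bQ: "bernstein Q (\<lambda>x. x $ j) \<sigma> K" for j
      using b[rule_format, of j] unfolding bernstein_def Q_def
      by (simp add: integrable_distr_eq integral_distr)
    \<comment> \<open>This makes the logarithm in \<open>delta\<close> nonnegative, hence
      \<open>M * delta\<close> a legitimate choice of \<open>a0\<close>.\<close>
    have "1 \<le> 2 * real CARD('p)"
      using zero_less_card_finite[where 'a = 'p] by (simp del: zero_less_card_finite)
    then have \<delta>: "0 \<le> delta CARD('n) CARD('p) \<sigma> K" unfolding delta_def using \<sigma> K by simp
    have "1 - exp (- t) \<le> measure P {\<omega> \<in> space P.
        (INF u\<in>{u. Lnorm P0 2 (\<lambda>x. X0 x \<bullet> u) = 1 \<and> l1_norm u \<le> M}. ereal (emp_norm_sq (X \<omega> *v u))) - 1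
          \<ge> ereal (- (D_const m C * (16 * (M * delta CARD('n) CARD('p) \<sigma> K) + sqrt (2 * t / real CARD('n)))
              powr ((m - 2) / (m - 1))
              + 8 * (D_const m C)\<^sup>2 / 3 * (t / real CARD('n)) powr ((m - 2) / (m - 1))))}"
    proof (rule core[OF _ _ t])
      fix F assume F: "finite F" "F \<noteq> {}" "F \<subseteq> {u. Lnorm P0 2 (\<lambda>x. X0 x \<bullet> u) = 1 \<and> l1_norm u \<le> M}"
      show "(\<integral>y. Max ((\<lambda>u. \<Sum>i\<in>UNIV. y i \<bullet> u) ` F) \<partial>PiM (UNIV :: 'n set) (\<lambda>_. symmetrize Q))
          \<le> CARD('n) * (M * delta CARD('n) CARD('p) \<sigma> K)"
        by (rule expectation_Max_inner_sum_le_l1[OF Q _ _ F(1,2) _ _ bQ K \<sigma>]) (use F M in auto)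
    qed (use M \<delta> in auto)
    then show "1 - exp (- t) \<le> measure P {\<omega> \<in> space P.
        (INF u\<in>{u. Lnorm P0 2 (\<lambda>x. X0 x \<bullet> u) = 1 \<and> l1_norm u \<le> M}. ereal (emp_norm_sq (X \<omega> *v u))) - 1
          \<ge> ereal (- Delta_L CARD('n) CARD('p) m C \<sigma> K M t)}"
      by (simp add: Delta_L_def mult.assoc)
  qed
qed

end
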